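(* There exists a constant $C>0$ such that the following holds. Let $M,N\ge 200$ be integers, let $d=MN$, and let $b\in\ell_2^{(M,N)}$ be such that $G_{(M,N)}(b)$ is an orthonormal basis in $\ell_2^{(M,N)}$. Then, for all positive integers $Q\le N/16$ and $R\le M/16$, $$\frac1M\sum_{j=MQ}^{d-1}|b(j)|^2+\frac1N\sum_{k=NR}^{d-1}|\mathcal{F}_{(M,N)}b(k)|^2\ge\frac{C}{QR}.$$
   Context: For $M,N\in\mathbb{N}$ put $d=MN$ and $\mathbb{Z}_d=\mathbb{Z}/d\mathbb{Z}$. $\ell_2^{(M,N)}$ is the space of all functions $b:\mathbb{Z}_d\to\mathbb{C}$ with norm $\|b\|_{(M,N)}^2=\frac1M\sum_{j=0}^{d-1}|b(j)|^2$ (and the corresponding inner product). The finite Fourier transform $\mathcal{F}_{(M,N)}b(k)=\frac1M\sum_{j=0}^{d-1}b(j)e^{-2\pi i jk/d}$ is unitary from $\ell_2^{(M,N)}$ to $\ell_2^{(N,M)}$. $M\mathbb{Z}_d$ denotes the set $\{Mk:k\in\mathbb{Z}\}$ modulo $d$, and $N\mathbb{Z}_d$ the set $\{Nk:k\in\mathbb{Z}\}$ modulo $d$. The Gabor system generated by $b\in\ell_2^{(M,N)}$ is $$G_{(M,N)}(b)=\{e^{2\pi i \ell j/d}\,b(j-k)\}_{(k,\ell)\in M\mathbb{Z}_d\times N\mathbb{Z}_d},$$ where each element is viewed as a function of $j\in\mathbb{Z}_d$. *)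

theory Defs
  imports "HOL-Analysis.Analysis"
begin

text \<open>
  With \<open>d = M * N\<close>, a function on \<open>Z/dZ\<close> is represented by a \<open>d\<close>-periodic function
  on the integers, so that \<open>b (j - k)\<close> is translation modulo \<open>d\<close>.
\<close>

definition l2_space :: "nat \<Rightarrow> nat \<Rightarrow> (int \<Rightarrow> complex) set" where
  "l2_space M N = {b. \<forall>j. b (j + int (M * N)) = b j}"

definition l2_inner :: "nat \<Rightarrow> nat \<Rightarrow> (int \<Rightarrow> complex) \<Rightarrow> (int \<Rightarrow> complex) \<Rightarrow> complex" where
  "l2_inner M N f g = 1 / of_nat M * (\<Sum>j = 0..<int (M * N). f j * cnj (g j))"

definition finite_fourier :: "nat \<Rightarrow> nat \<Rightarrow> (int \<Rightarrow> complex) \<Rightarrow> int \<Rightarrow> complex" where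
  "finite_fourier M N b k =
     1 / of_nat M *
       (\<Sum>j = 0..<int (M * N).
          b j * exp (- (2 * of_real pi * \<i> * of_int j * of_int k / of_nat (M * N))))"

text \<open>
  The set \<open>m Z_d\<close>, given by the representatives in \<open>{0..<d}\<close>; this makes each residue class
  occur exactly once as an index of the Gabor system.
\<close>

definition multiples_mod :: "nat \<Rightarrow> nat \<Rightarrow> int set" where
  "multiples_mod m d = {(int m * k) mod int d | k. True}"

definition gabor_index :: "nat \<Rightarrow> nat \<Rightarrow> (int \<times> int) set" where
  "gabor_index M N = multiples_mod M (M * N) \<times> multiples_mod N (M * N)"

definition gabor :: "nat \<Rightarrow> nat \<Rightarrow> (int \<Rightarrow> complex) \<Rightarrow> int \<times> int \<Rightarrow> int \<Rightarrow> complex" where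
  "gabor M N b = (\<lambda>(k, l) j.
     exp (2 * of_real pi * \<i> * of_int l * of_int j / of_nat (M * N)) * b (j - k))"

text \<open>
  The space is finite-dimensional, so an orthonormal basis is a finite orthonormal family
  whose complex linear combinations exhaust the space.
\<close>

definition l2_orthonormal_basis ::
    "nat \<Rightarrow> nat \<Rightarrow> 'i set \<Rightarrow> ('i \<Rightarrow> int \<Rightarrow> complex) \<Rightarrow> bool" where
  "l2_orthonormal_basis M N I e \<longleftrightarrow>
     finite I \<and>
     (\<forall>p\<in>I. e p \<in> l2_space M N) \<and>
     (\<forall>p\<in>I. \<forall>q\<in>I. l2_inner M N (e p) (e q) = (if p = q then 1 else 0)) \<and>
     (\<forall>f\<in>l2_space M N. \<exists>c :: 'i \<Rightarrow> complex. \<forall>j. f j = (\<Sum>p\<in>I. c p * e p j))"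

end

theory Submission
  imports Defs
begin

text \<open>
  The Zak transform of \<open>b\<close> is unimodular because the Gabor system is orthonormal, and it is
  quasi-periodic in one variable and periodic in the other, so it winds once more along one side of
  the fundamental rectangle than along the opposite one. Restricted to one variable it is a
  trigonometric polynomial whose coefficients are values of \<open>b\<close>, respectively of its Fourier
  transform. Convolution with a trapezoid kernel that reproduces the first \<open>Q\<close>
  (respectively \<open>R\<close>) frequencies therefore splits it into a Lipschitz part and an error whose
  \<open>L\<^sup>2\<close> norm is bounded by the tail. If both tails were smaller than \<open>C/(QR)\<close>, averaging
  over translates would give a grid of about \<open>QR\<close> points on which both errors are tiny. All jumps
  of the Zak transform along this grid are then below \<open>\<surd>2\<close>, and such a function has no
  winding.
\<close>

section \<open>Characters and periodic sums\<close>

definition unit_char :: "real \<Rightarrow> complex" where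
  "unit_char x = cis (2 * pi * x)"

lemma unit_char_add: "unit_char (x + y) = unit_char x * unit_char y"
  by (simp add: unit_char_def cis_mult ring_distribs)

lemma unit_char_0 [simp]: "unit_char 0 = 1"
  by (simp add: unit_char_def)

lemma unit_char_of_int [simp]: "unit_char (of_int k) = 1"
  by (simp add: unit_char_def)

lemma norm_unit_char [simp]: "cmod (unit_char x) = 1"
  by (simp add: unit_char_def)

lemma unit_char_nonzero [simp]: "unit_char x \<noteq> 0"
  by (metis norm_unit_char norm_zero zero_neq_one)

lemma cnj_unit_char: "cnj (unit_char x) = unit_char (- x)"
  by (simp add: unit_char_def cis_cnj)

lemma unit_char_eq_exp: "unit_char x = exp (2 * of_real pi * \<i> * of_real x)"
  by (simp add: unit_char_def cis_conv_exp mult_ac)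

lemma unit_char_eq_1_imp:
  assumes "unit_char x = 1"
  obtains k :: int where "x = of_int k"
proof -
  have "cos (2 * pi * x) = 1"
    using assms by (metis unit_char_def cis.sel(1) one_complex.sel(1))
  then obtain k :: int where "2 * pi * x = of_int k * 2 * pi"
    using cos_one_2pi_int by blast
  then have "x = of_int k"
    by simp
  then show ?thesis
    using that by blast
qed

lemma norm_unit_char_diff: "cmod (unit_char x - unit_char y) \<le> 2 * pi * \<bar>x - y\<bar>"
proof -
  have "unit_char x - unit_char y = unit_char y * (unit_char (x - y) - 1)"
    by (simp add: right_diff_distrib flip: unit_char_add)
  then have "cmod (unit_char x - unit_char y) = cmod (unit_char (x - y) - 1)"
    by (simp add: norm_mult)
  also have "\<dots> = 2 * \<bar>sin (2 * pi * (x - y) / 2)\<bar>"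
    by (metis dist_exp_i_1 unit_char_def cis_conv_exp)
  also have "\<dots> \<le> 2 * \<bar>2 * pi * (x - y) / 2\<bar>"
    by (intro mult_left_mono abs_sin_x_le_abs_x) simp
  finally show ?thesis
    by (simp add: abs_mult)
qed

section \<open>Sums over a full period\<close>

lemma periodic_mod:
  fixes f :: "int \<Rightarrow> 'a" and P :: int
  assumes "\<And>t. f (t + P) = f t"
  shows "f (x mod P) = f x"
proof -
  have up: "f (t + int n * P) = f t" for t n
  proof (induction n)
    case (Suc n)
    have "f (t + int (Suc n) * P) = f ((t + int n * P) + P)"
      by (simp add: algebra_simps)
    then show ?case
      using Suc assms by simp
  qed simp
  have "f (t + k * P) = f t" for t k
  proof (cases "k \<ge> 0")
    case True
    then show ?thesis
      using up[of t "nat k"] by simp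
  next
    case False
    then show ?thesis
      using up[of "t + k * P" "nat (- k)"] by simp
  qed
  from this[of "x mod P" "x div P"] show ?thesis
    by simp
qed

lemma sum_periodic_shift:
  fixes f :: "int \<Rightarrow> 'a :: comm_monoid_add" and P :: int
  assumes "\<And>t. f (t + P) = f t"
  shows "(\<Sum>t = 0..<P. f (t + s)) = (\<Sum>t = 0..<P. f t)"
proof (rule sum.reindex_bij_witness[where i = "\<lambda>t. (t - s) mod P" and j = "\<lambda>t. (t + s) mod P"])
  show "f ((t + s) mod P) = f (t + s)" for t
    using periodic_mod[of f P, OF assms] .
qed (auto simp: mod_simps)

lemma sum_periodic_reflect:
  fixes f :: "int \<Rightarrow> 'a :: comm_monoid_add" and P :: int
  assumes "\<And>t. f (t + P) = f t"
  shows "(\<Sum>t = 0..<P. f (s - t)) = (\<Sum>t = 0..<P. f t)"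
proof (rule sum.reindex_bij_witness[where i = "\<lambda>t. (s - t) mod P" and j = "\<lambda>t. (s - t) mod P"])
  show "f ((s - t) mod P) = f (s - t)" for t
    using periodic_mod[of f P, OF assms] .
qed (auto simp: mod_simps)

text \<open>Division with remainder, \<open>j = m + M * t\<close>. Starting at \<open>M * Q\<close>
  means exactly \<open>t \<ge> Q\<close> in every residue class, so a tail of \<open>b\<close> turns
  into the high-frequency tails of the polynomials attached to the classes.\<close>

lemma sum_split_residues:
  fixes f :: "int \<Rightarrow> 'a :: comm_monoid_add" and M N Q :: int
  assumes "M > 0"
  shows "(\<Sum>j = M * Q..<M * N. f j) = (\<Sum>m = 0..<M. \<Sum>t = Q..<N. f (m + M * t))"
proof -
  have "(\<Sum>j = M * Q..<M * N. f j) = (\<Sum>(m, t) \<in> {0..<M} \<times> {Q..<N}. f (m + M * t))"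
  proof (rule sum.reindex_bij_witness[where i = "\<lambda>(m, t). m + M * t" and j = "\<lambda>j. (j mod M, j div M)"])
    fix j assume j: "j \<in> {M * Q..<M * N}"
    have "Q \<le> j div M"
      using j assms by (metis atLeastLessThan_iff zdiv_mono1 nonzero_mult_div_cancel_left less_numeral_extra(3))
    moreover have "j div M < N"
    proof (rule ccontr)
      assume "\<not> j div M < N"
      then have "M * N \<le> M * (j div M)"
        using assms by simp
      also have "\<dots> \<le> j"
        using assms by (simp add: flip: minus_mod_eq_mult_div)
      finally show False
        using j by simp
    qed
    ultimately show "(j mod M, j div M) \<in> {0..<M} \<times> {Q..<N}"
      using assms by simp
  next
    fix p assume "p \<in> {0..<M} \<times> {Q..<N}"
    then obtain m t where p: "p = (m, t)" "0 \<le> m" "m < M" "Q \<le> t" "t < N"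
      by auto
    have "M * Q \<le> M * t"
      using p assms by simp
    moreover have "M * t + M \<le> M * N"
      using p assms mult_left_mono[of "t + 1" N M] by (simp add: ring_distribs)
    ultimately have "M * Q \<le> m + M * t" "m + M * t < M * N"
      using p by linarith+
    then show "(case p of (m, t) \<Rightarrow> m + M * t) \<in> {M * Q..<M * N}"
      using p by simp
  qed auto
  then show ?thesis
    by (simp add: sum.cartesian_product)
qed

section \<open>Orthogonality of characters and Parseval\<close>

lemma sum_unit_char:
  fixes P :: nat and k :: int
  assumes "P > 0"
  shows "(\<Sum>t = 0..<int P. unit_char (of_int k * of_int t / P)) = (if int P dvd k then of_nat P else 0)"
proof (cases "int P dvd k")
  case True
  then obtain q where k: "k = int P * q" ..
  have "unit_char (of_int k * of_int t / P) = 1" for t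
  proof -
    have "of_int k * of_int t / real P = of_int (q * t)"
      using assms by (simp add: k)
    then show ?thesis
      by (simp only: unit_char_of_int)
  qed
  then show ?thesis
    using True by simp
next
  case False
  let ?f = "\<lambda>t::int. unit_char (of_int k * of_int t / P)"
  have step: "?f (t + s) = ?f s * ?f t" for s t
    by (simp add: ring_distribs add_divide_distrib add.commute flip: unit_char_add)
  have "?f (int P) = 1"
    using assms by simp
  \<comment> \<open>Shifting the index by one leaves the full-period sum unchanged but also
    multiplies it by \<open>?f 1\<close>, so the sum vanishes as soon as
    \<open>?f 1 \<noteq> 1\<close>.\<close>
  then have "sum ?f {0..<int P} = (\<Sum>t = 0..<int P. ?f (t + 1))"
    by (intro sum_periodic_shift[symmetric]) (simp only: step mult_1_left)
  also have "\<dots> = ?f 1 * sum ?f {0..<int P}"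
    by (simp only: step sum_distrib_left)
  finally have "(?f 1 - 1) * sum ?f {0..<int P} = 0"
    by (simp add: algebra_simps)
  moreover have "?f 1 \<noteq> 1"
  proof
    assume "?f 1 = 1"
    then obtain q :: int where "of_int k / real P = of_int q"
      by (auto elim: unit_char_eq_1_imp)
    then have "real_of_int k = real_of_int (int P * q)"
      using assms by (simp add: field_simps)
    then have "k = int P * q"
      by (simp only: of_int_eq_iff)
    then show False
      using False by simp
  qed
  ultimately show ?thesis
    using False by simp
qed

lemma dvd_diff_residues:
  fixes P i j :: int
  assumes "i \<in> {0..<P}" "j \<in> {0..<P}"
  shows "P dvd i - j \<longleftrightarrow> i = j"
  using assms by (metis atLeastLessThan_iff mod_eq_dvd_iff mod_pos_pos_trivial)

text \<open>Frequencies taken from \<open>{0..<int P}\<close> are pairwise incongruent modulo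
  \<open>P\<close>, so orthogonality kills the off-diagonal terms of the expanded square.\<close>

lemma parseval:
  fixes P :: nat and c :: "int \<Rightarrow> complex"
  assumes "P > 0" "A \<subseteq> {0..<int P}"
  shows "(\<Sum>t = 0..<int P. (cmod (\<Sum>j\<in>A. c j * unit_char (of_int j * of_int t / P)))\<^sup>2)
    = P * (\<Sum>j\<in>A. (cmod (c j))\<^sup>2)"
proof -
  let ?e = "\<lambda>j t. unit_char (of_int j * of_int t / P)"
  have fin: "finite A"
    using assms(2) finite_subset by blast
  have "complex_of_real (\<Sum>t = 0..<int P. (cmod (\<Sum>j\<in>A. c j * ?e j t))\<^sup>2)
      = (\<Sum>t = 0..<int P. (\<Sum>i\<in>A. c i * ?e i t) * cnj (\<Sum>j\<in>A. c j * ?e j t))"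
    by (simp only: of_real_sum complex_norm_square)
  also have "\<dots> = (\<Sum>t = 0..<int P. \<Sum>i\<in>A. \<Sum>j\<in>A. c i * cnj (c j) * ?e (i - j) t)"
  proof (intro sum.cong refl)
    fix t
    have "c i * ?e i t * cnj (c j * ?e j t) = c i * cnj (c j) * ?e (i - j) t" for i j
    proof -
      have "?e i t * cnj (?e j t) = ?e (i - j) t"
        by (simp add: cnj_unit_char left_diff_distrib diff_divide_distrib flip: unit_char_add)
      then show ?thesis
        by (simp add: mult_ac)
    qed
    then show "(\<Sum>i\<in>A. c i * ?e i t) * cnj (\<Sum>j\<in>A. c j * ?e j t)
        = (\<Sum>i\<in>A. \<Sum>j\<in>A. c i * cnj (c j) * ?e (i - j) t)"
      by (simp only: cnj_sum sum_product)
  qed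
  also have "\<dots> = (\<Sum>i\<in>A. \<Sum>t = 0..<int P. \<Sum>j\<in>A. c i * cnj (c j) * ?e (i - j) t)"
    by (rule sum.swap)
  also have "\<dots> = (\<Sum>i\<in>A. \<Sum>j\<in>A. \<Sum>t = 0..<int P. c i * cnj (c j) * ?e (i - j) t)"
    by (intro sum.cong refl sum.swap)
  also have "\<dots> = (\<Sum>i\<in>A. \<Sum>j\<in>A. c i * cnj (c j) * (if j = i then of_nat P else 0))"
  proof (intro sum.cong refl)
    fix i j assume "i \<in> A" "j \<in> A"
    then have "int P dvd i - j \<longleftrightarrow> j = i"
      using dvd_diff_residues[of i "int P" j] assms(2) by blast
    then show "(\<Sum>t = 0..<int P. c i * cnj (c j) * ?e (i - j) t)
        = c i * cnj (c j) * (if j = i then of_nat P else 0)"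
      by (simp only: sum_unit_char[OF assms(1)] flip: sum_distrib_left)
  qed
  also have "\<dots> = (\<Sum>i\<in>A. c i * cnj (c i) * of_nat P)"
    by (simp add: if_distrib fin cong: if_cong)
  also have "\<dots> = complex_of_real (P * (\<Sum>j\<in>A. (cmod (c j))\<^sup>2))"
    by (simp add: sum_distrib_left mult_ac flip: complex_norm_square)
  finally show ?thesis
    by (simp only: of_real_eq_iff)
qed

section \<open>Absence of winding on a grid\<close>

text \<open>
  A continuous logarithm of \<open>g\<close> exists along the grid because the logarithms of the increments
  around each cell cancel exactly, so the winding of \<open>g\<close> along two opposite sides agrees.
\<close>

lemma no_winding_if_small_jumps:
  fixes g :: "nat \<Rightarrow> nat \<Rightarrow> complex" and y :: "nat \<Rightarrow> real"
  assumes nz: "\<And>i j. i \<le> I \<Longrightarrow> j \<le> J \<Longrightarrow> g i j \<noteq> 0"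
    and hor: "\<And>i j. i < I \<Longrightarrow> j \<le> J \<Longrightarrow> Re (g (Suc i) j / g i j) > 0"
    and vert: "\<And>i j. i \<le> I \<Longrightarrow> j < J \<Longrightarrow> Re (g i (Suc j) / g i j) > 0"
    and top: "\<And>i. i \<le> I \<Longrightarrow> g i J = g i 0"
    and side: "\<And>j. j \<le> J \<Longrightarrow> g I j = unit_char (y j) * g 0 j"
    and dy: "\<And>j. j < J \<Longrightarrow> \<bar>y (Suc j) - y j\<bar> < 1 / 4"
  shows "y J = y 0"
proof -
  define a where "a i j = Ln (g (Suc i) j / g i j)" for i j
  define c where "c i j = Ln (g i (Suc j) / g i j)" for i j
  \<comment> \<open>In the right half-plane both arguments are below pi/2 in absolute value, so
    their sum stays in the principal branch and \<open>Ln\<close> is additive.\<close>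
  have Ln_mult: "Ln (w * z) = Ln w + Ln z" if "Re w > 0" "Re z > 0" for w z
  proof -
    have nz: "w \<noteq> 0" "z \<noteq> 0"
      using that by auto
    then have "\<bar>Im (Ln w)\<bar> < pi / 2" "\<bar>Im (Ln z)\<bar> < pi / 2"
      using that Re_Ln_pos_lt by blast+
    then show ?thesis
      using nz by (intro Ln_times_simple) linarith+
  qed
  \<comment> \<open>Both two-edge paths across the cell multiply to the same quotient
    \<open>g (Suc i) (Suc j) / g i j\<close>.\<close>
  have cell: "a i j + c (Suc i) j = c i j + a i (Suc j)" if "i < I" "j < J" for i j
  proof -
    have "a i j + c (Suc i) j = Ln (g (Suc i) j / g i j * (g (Suc i) (Suc j) / g (Suc i) j))"
      unfolding a_def c_def using that hor vert by (intro Ln_mult[symmetric]) auto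
    also have "\<dots> = Ln (g i (Suc j) / g i j * (g (Suc i) (Suc j) / g i (Suc j)))"
      using that nz by (simp add: field_simps)
    also have "\<dots> = c i j + a i (Suc j)"
      unfolding a_def c_def using that hor vert by (intro Ln_mult) auto
    finally show ?thesis .
  qed
  have col: "(\<Sum>i<I. a i j) + c I j = c 0 j + (\<Sum>i<I. a i (Suc j))" if "j < J" for j
  proof -
    have "c I j - c 0 j = (\<Sum>i<I. c (Suc i) j - c i j)"
      by (rule sum_lessThan_telescope[symmetric])
    also have "\<dots> = (\<Sum>i<I. a i (Suc j) - a i j)"
      using cell[OF _ that] by (intro sum.cong) (auto simp: algebra_simps)
    finally show ?thesis
      by (simp add: sum_subtractf algebra_simps)
  qed
  have "(\<Sum>i<I. a i 0) + (\<Sum>j<n. c I j) = (\<Sum>j<n. c 0 j) + (\<Sum>i<I. a i n)" if "n \<le> J" for n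
    using that
  proof (induction n)
    case (Suc n)
    then show ?case
      using col[of n] by (simp add: algebra_simps)
  qed simp
  from this[of J] have "(\<Sum>i<I. a i 0) + (\<Sum>j<J. c I j) = (\<Sum>j<J. c 0 j) + (\<Sum>i<I. a i J)"
    by simp
  \<comment> \<open>Periodicity makes the row sums at the bottom and at the top equal, so the two
    vertical sides carry the same total logarithm.\<close>
  moreover have "a i J = a i 0" if "i < I" for i
    using top that by (simp add: a_def)
  ultimately have eq: "(\<Sum>j<J. c I j) = (\<Sum>j<J. c 0 j)"
    by simp
  \<comment> \<open>Each increment on the side \<open>I\<close> carries the extra rotation
    \<open>unit_char (y (Suc j) - y j)\<close>. The bound 1/4 keeps its angle below pi/2, so the
    principal logarithm returns this angle itself and the angles telescope.\<close>
  have rot: "c I j = of_real (2 * pi * (y (Suc j) - y j)) * \<i> + c 0 j" if "j < J" for j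
  proof -
    let ?d = "y (Suc j) - y j"
    have d: "\<bar>2 * pi * ?d\<bar> < pi / 2"
      using dy[OF that] by (simp add: abs_mult)
    have "g I (Suc j) / g I j = unit_char ?d * (g 0 (Suc j) / g 0 j)"
      using that nz[of 0 j] side[of j] side[of "Suc j"] unit_char_add[of ?d "y j"]
      by (simp add: field_simps)
    moreover have "Re (unit_char ?d) > 0"
      unfolding unit_char_def cis.sel using d by (intro cos_gt_zero_pi) linarith+
    moreover have "Re (g 0 (Suc j) / g 0 j) > 0"
      using vert[of 0 j] that by simp
    ultimately have "c I j = Ln (unit_char ?d) + c 0 j"
      unfolding c_def using Ln_mult by metis
    moreover have "Ln (unit_char ?d) = of_real (2 * pi * ?d) * \<i>"
      unfolding unit_char_def using d by (intro Ln_cis) (simp only: greaterThanAtMost_iff, linarith)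
    ultimately show ?thesis
      by simp
  qed
  have "(\<Sum>j<J. c I j) = (\<Sum>j<J. of_real (2 * pi * (y (Suc j) - y j)) * \<i> + c 0 j)"
    by (intro sum.cong refl rot) simp
  also have "\<dots> = of_real (2 * pi * (\<Sum>j<J. y (Suc j) - y j)) * \<i> + (\<Sum>j<J. c 0 j)"
    by (simp only: sum.distrib sum_distrib_left sum_distrib_right of_real_sum)
  finally have "of_real (2 * pi * (y J - y 0)) * \<i> = 0"
    unfolding sum_lessThan_telescope using eq by simp
  then show ?thesis
    by simp
qed

section \<open>Smoothing with a trapezoid kernel\<close>

lemma sum_int_squares_le: "(\<Sum>i = 0..<int n. (real_of_int i)\<^sup>2) \<le> real n ^ 3 / 3"
proof (induction n)
  case (Suc n)
  have "{0..<int (Suc n)} = insert (int n) {0..<int n}"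
    by auto
  then have "(\<Sum>i = 0..<int (Suc n). (real_of_int i)\<^sup>2) = (real n)\<^sup>2 + (\<Sum>i = 0..<int n. (real_of_int i)\<^sup>2)"
    by simp
  also have "\<dots> \<le> (real n)\<^sup>2 + real n ^ 3 / 3"
    using Suc.IH by simp
  also have "\<dots> \<le> real (Suc n) ^ 3 / 3"
    by (simp add: power2_eq_square power3_eq_cube field_simps)
  finally show ?case .
qed simp

definition dirichlet :: "nat \<Rightarrow> nat \<Rightarrow> int \<Rightarrow> complex" where
  "dirichlet P n t = (\<Sum>j = 0..<int n. unit_char (of_int j * of_int t / P))"

lemma unit_char_shift_period:
  assumes "P > 0"
  shows "unit_char (of_int j * of_int (t + int P) / real P) = unit_char (of_int j * of_int t / real P)"
  using assms by (simp add: ring_distribs add_divide_distrib unit_char_add)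

lemma dirichlet_periodic: "P > 0 \<Longrightarrow> dirichlet P n (t + int P) = dirichlet P n t"
  unfolding dirichlet_def by (intro sum.cong refl unit_char_shift_period)

lemma dirichlet_energy:
  assumes "P > 0" "n \<le> P"
  shows "(\<Sum>t = 0..<int P. (cmod (dirichlet P n (t + h)))\<^sup>2) = real P * real n"
proof -
  have "(\<Sum>t = 0..<int P. (cmod (dirichlet P n (t + h)))\<^sup>2) = (\<Sum>t = 0..<int P. (cmod (dirichlet P n t))\<^sup>2)"
    using assms by (intro sum_periodic_shift) (simp add: dirichlet_periodic)
  also have "\<dots> = real P * real n"
    using parseval[of P "{0..<int n}" "\<lambda>_. 1"] assms by (simp add: dirichlet_def)
  finally show ?thesis .
qed

text \<open>Translation by \<open>h\<close> turns the coefficient 1 at frequency \<open>j\<close>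
  into \<open>unit_char (j * h / P)\<close>, a change of size at most
  \<open>2 * pi * j * h / P\<close>. Parseval then reduces everything to a sum of squares of
  \<open>j\<close>.\<close>

lemma dirichlet_diff_energy:
  assumes "P > 0" "n \<le> P"
  shows "(\<Sum>t = 0..<int P. (cmod (dirichlet P n (t + h) - dirichlet P n t))\<^sup>2)
    \<le> real P * ((2 * pi * of_int h / P)\<^sup>2 * (real n ^ 3 / 3))"
proof -
  let ?c = "\<lambda>j::int. unit_char (of_int j * of_int h / P) - 1"
  have "dirichlet P n (t + h) - dirichlet P n t = (\<Sum>j = 0..<int n. ?c j * unit_char (of_int j * of_int t / P))" for t
    unfolding dirichlet_def sum_subtractf[symmetric]
    by (intro sum.cong refl) (simp add: left_diff_distrib ring_distribs add_divide_distrib add.commute flip: unit_char_add)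
  then have "(\<Sum>t = 0..<int P. (cmod (dirichlet P n (t + h) - dirichlet P n t))\<^sup>2) = P * (\<Sum>j = 0..<int n. (cmod (?c j))\<^sup>2)"
    using parseval[of P "{0..<int n}" ?c] assms by simp
  also have "\<dots> \<le> P * (\<Sum>j = 0..<int n. (2 * pi * of_int h / P)\<^sup>2 * (real_of_int j)\<^sup>2)"
  proof (intro mult_left_mono sum_mono)
    fix j :: int
    have "cmod (?c j) \<le> \<bar>2 * pi * (of_int j * of_int h / P)\<bar>"
      using norm_unit_char_diff[of "of_int j * of_int h / P" 0] by (simp add: abs_mult)
    then have "(cmod (?c j))\<^sup>2 \<le> (2 * pi * (of_int j * of_int h / P))\<^sup>2"
      by (metis power2_abs power_mono norm_ge_zero)
    then show "(cmod (?c j))\<^sup>2 \<le> (2 * pi * of_int h / P)\<^sup>2 * (real_of_int j)\<^sup>2"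
      by (simp add: power_mult_distrib power_divide mult_ac)
  qed simp
  also have "\<dots> \<le> P * ((2 * pi * of_int h / P)\<^sup>2 * (real n ^ 3 / 3))"
    unfolding sum_distrib_left[symmetric]
    by (intro mult_left_mono sum_int_squares_le) auto
  finally show ?thesis .
qed

text \<open>
  A product of two Dirichlet kernels has as its Fourier coefficients the normalised correlation of
  two intervals, a trapezoid that equals 1 on \<open>{0..<Q}\<close>; its increments are controlled in
  \<open>L\<^sup>1\<close> by Cauchy--Schwarz.
\<close>

definition trapezoid_kernel :: "nat \<Rightarrow> nat \<Rightarrow> int \<Rightarrow> complex" where
  "trapezoid_kernel P Q t = dirichlet P (2 * Q) t * cnj (dirichlet P Q t) / (real P * real Q)"

lemma trapezoid_kernel_periodic: "P > 0 \<Longrightarrow> trapezoid_kernel P Q (t + int P) = trapezoid_kernel P Q t"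
  by (simp add: trapezoid_kernel_def dirichlet_periodic)

text \<open>The discrete product rule splits the increment into two products, each containing the
  increment of one Dirichlet kernel and a value of the other. Cauchy-Schwarz bounds each product by
  the two energies.\<close>

lemma trapezoid_kernel_diff_norm:
  fixes h :: int
  assumes "Q > 0" "2 * Q \<le> P" "h \<ge> 0"
  shows "(\<Sum>t = 0..<int P. cmod (trapezoid_kernel P Q (t + h) - trapezoid_kernel P Q t))
    \<le> 2 * pi * h / P * (5 / 2 * Q)"
proof -
  have P: "P > 0" "Q \<le> P"
    using assms by auto
  let ?A = "dirichlet P (2 * Q)" and ?B = "dirichlet P Q"
  let ?S1 = "\<Sum>t = 0..<int P. cmod (?A (t + h) - ?A t) * cmod (?B (t + h))"
  let ?S2 = "\<Sum>t = 0..<int P. cmod (?A t) * cmod (?B (t + h) - ?B t)"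
  define w where "w = 2 * pi * h / P"
  have w: "w \<ge> 0"
    using assms by (simp add: w_def)
  have "?S1\<^sup>2 \<le> (real P * (w\<^sup>2 * (real (2 * Q) ^ 3 / 3))) * (real P * Q)"
  proof -
    have "?S1\<^sup>2 \<le> (\<Sum>t = 0..<int P. (cmod (?A (t + h) - ?A t))\<^sup>2) * (\<Sum>t = 0..<int P. (cmod (?B (t + h)))\<^sup>2)"
      by (rule Cauchy_Schwarz_ineq_sum)
    also have "\<dots> \<le> (real P * (w\<^sup>2 * (real (2 * Q) ^ 3 / 3))) * (real P * Q)"
      unfolding dirichlet_energy[OF P] w_def
      using dirichlet_diff_energy[of P "2 * Q" h] assms P by (intro mult_right_mono) auto
    finally show ?thesis .
  qed
  also have "\<dots> = 8 / 3 * (P * w * Q\<^sup>2)\<^sup>2"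
    by (simp add: power2_eq_square power3_eq_cube)
  \<comment> \<open>Here 5/3 and, for \<open>?S2\<close>, 5/6 are rational upper bounds for the
    square roots of 8/3 and 2/3; they add up to the final constant 5/2.\<close>
  also have "\<dots> \<le> 25 / 9 * (P * w * Q\<^sup>2)\<^sup>2"
    by (intro mult_right_mono) auto
  also have "\<dots> = (5 / 3 * P * w * Q\<^sup>2)\<^sup>2"
    by (simp add: power_mult_distrib power_divide)
  finally have S1: "?S1 \<le> 5 / 3 * P * w * Q\<^sup>2"
    by (rule power2_le_imp_le) (use w in simp)
  have "?S2\<^sup>2 \<le> (real P * real (2 * Q)) * (real P * (w\<^sup>2 * (real Q ^ 3 / 3)))"
  proof -
    have "?S2\<^sup>2 \<le> (\<Sum>t = 0..<int P. (cmod (?A t))\<^sup>2) * (\<Sum>t = 0..<int P. (cmod (?B (t + h) - ?B t))\<^sup>2)"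
      by (rule Cauchy_Schwarz_ineq_sum)
    also have "\<dots> \<le> (real P * real (2 * Q)) * (real P * (w\<^sup>2 * (real Q ^ 3 / 3)))"
      unfolding dirichlet_energy[of P "2 * Q" 0, OF P(1) assms(2), unfolded add_0_right] w_def
      using dirichlet_diff_energy[OF P, of h] by (intro mult_left_mono) auto
    finally show ?thesis .
  qed
  also have "\<dots> = 2 / 3 * (P * w * Q\<^sup>2)\<^sup>2"
    by (simp add: power2_eq_square power3_eq_cube)
  also have "\<dots> \<le> 25 / 36 * (P * w * Q\<^sup>2)\<^sup>2"
    by (intro mult_right_mono) auto
  also have "\<dots> = (5 / 6 * P * w * Q\<^sup>2)\<^sup>2"
    by (simp add: power_mult_distrib power_divide)
  finally have S2: "?S2 \<le> 5 / 6 * P * w * Q\<^sup>2"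
    by (rule power2_le_imp_le) (use w in simp)
  have "(\<Sum>t = 0..<int P. cmod (trapezoid_kernel P Q (t + h) - trapezoid_kernel P Q t))
      \<le> (\<Sum>t = 0..<int P. (cmod (?A (t + h) - ?A t) * cmod (?B (t + h)) + cmod (?A t) * cmod (?B (t + h) - ?B t)) / (real P * Q))"
  proof (rule sum_mono)
    fix t
    have "trapezoid_kernel P Q (t + h) - trapezoid_kernel P Q t
        = ((?A (t + h) - ?A t) * cnj (?B (t + h)) + ?A t * cnj (?B (t + h) - ?B t)) / (real P * Q)"
      by (simp add: trapezoid_kernel_def algebra_simps flip: diff_divide_distrib)
    also have "cmod \<dots> = cmod ((?A (t + h) - ?A t) * cnj (?B (t + h)) + ?A t * cnj (?B (t + h) - ?B t)) / (real P * Q)"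
      by (simp add: norm_divide norm_mult del: complex_cnj_diff)
    also have "\<dots> \<le> (cmod (?A (t + h) - ?A t) * cmod (?B (t + h)) + cmod (?A t) * cmod (?B (t + h) - ?B t)) / (real P * Q)"
      by (intro divide_right_mono order_trans[OF norm_triangle_ineq])
        (simp_all add: norm_mult del: complex_cnj_diff)
    finally show "cmod (trapezoid_kernel P Q (t + h) - trapezoid_kernel P Q t) \<le> \<dots>" .
  qed
  also have "\<dots> = (?S1 + ?S2) / (real P * Q)"
    by (simp only: sum.distrib flip: sum_divide_distrib)
  also have "\<dots> \<le> (5 / 3 * P * w * Q\<^sup>2 + 5 / 6 * P * w * Q\<^sup>2) / (real P * Q)"
    using S1 S2 by (intro divide_right_mono add_mono) auto
  also have "\<dots> = w * (5 / 2 * Q)"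
    using P assms by (simp add: field_simps power2_eq_square)
  finally show ?thesis
    by (simp add: w_def)
qed

text \<open>The coefficient at \<open>j\<close> is the average, over \<open>l\<close> in
  \<open>{0..<int Q}\<close>, of the number \<open>n l\<close> of indices \<open>i\<close> in
  \<open>{0..<int (2 * Q)}\<close> congruent to \<open>l + j\<close>. Since
  \<open>2 * Q \<le> P\<close>, there is at most one such \<open>i\<close>; for
  \<open>j < int Q\<close> the number \<open>l + j\<close> itself is one.\<close>

lemma trapezoid_kernel_coeff:
  assumes "Q > 0" "2 * Q \<le> P" "j \<in> {0..<int P}"
  obtains r :: real where "(\<Sum>t = 0..<int P. trapezoid_kernel P Q t * unit_char (- (of_int j * of_int t / P))) = of_real r"
    "0 \<le> r" "r \<le> 1" "j < int Q \<Longrightarrow> r = 1"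
proof -
  have P: "P > 0"
    using assms by auto
  let ?e = "\<lambda>k t. unit_char (of_int k * of_int t / P)"
  define n where "n l = (\<Sum>i = 0..<int (2 * Q). if int P dvd i - l - j then 1 else 0 :: real)" for l
  have "(\<Sum>t = 0..<int P. trapezoid_kernel P Q t * unit_char (- (of_int j * of_int t / P)))
      = (\<Sum>t = 0..<int P. \<Sum>l = 0..<int Q. \<Sum>i = 0..<int (2 * Q). ?e (i - l - j) t / (real P * Q))"
  proof (rule sum.cong[OF refl])
    fix t
    have "?e i t * cnj (?e l t) * unit_char (- (of_int j * of_int t / P)) = ?e (i - l - j) t" for i l
      by (simp add: cnj_unit_char left_diff_distrib diff_divide_distrib flip: unit_char_add)
    then have "(\<Sum>l = 0..<int Q. \<Sum>i = 0..<int (2 * Q). ?e (i - l - j) t / (real P * Q))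
        = (\<Sum>l = 0..<int Q. \<Sum>i = 0..<int (2 * Q). ?e i t * cnj (?e l t)) * unit_char (- (of_int j * of_int t / P)) / (real P * Q)"
      by (simp add: sum_distrib_right sum_divide_distrib)
    also have "(\<Sum>l = 0..<int Q. \<Sum>i = 0..<int (2 * Q). ?e i t * cnj (?e l t))
        = dirichlet P (2 * Q) t * cnj (dirichlet P Q t)"
      unfolding dirichlet_def cnj_sum sum_product by (rule sum.swap)
    finally show "trapezoid_kernel P Q t * unit_char (- (of_int j * of_int t / P))
        = (\<Sum>l = 0..<int Q. \<Sum>i = 0..<int (2 * Q). ?e (i - l - j) t / (real P * Q))"
      by (simp add: trapezoid_kernel_def)
  qed
  also have "\<dots> = (\<Sum>l = 0..<int Q. \<Sum>t = 0..<int P. \<Sum>i = 0..<int (2 * Q). ?e (i - l - j) t / (real P * Q))"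
    by (rule sum.swap)
  also have "\<dots> = (\<Sum>l = 0..<int Q. \<Sum>i = 0..<int (2 * Q). \<Sum>t = 0..<int P. ?e (i - l - j) t / (real P * Q))"
    by (intro sum.cong refl sum.swap)
  also have "\<dots> = (\<Sum>l = 0..<int Q. \<Sum>i = 0..<int (2 * Q). (if int P dvd i - l - j then of_nat P else 0 :: complex) / (real P * Q))"
    by (intro sum.cong refl, subst sum_divide_distrib[symmetric], subst sum_unit_char[OF P], rule refl)
  also have "\<dots> = (\<Sum>l = 0..<int Q. \<Sum>i = 0..<int (2 * Q). complex_of_real ((if int P dvd i - l - j then 1 else 0) / Q))"
  proof (intro sum.cong refl)
    fix l i
    show "(if int P dvd i - l - j then of_nat P else 0 :: complex) / (real P * Q)
        = complex_of_real ((if int P dvd i - l - j then 1 else 0) / Q)"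
      using P by (cases "int P dvd i - l - j") simp_all
  qed
  also have "\<dots> = of_real ((\<Sum>l = 0..<int Q. n l) / Q)"
  proof -
    have "complex_of_real (n l / Q) = (\<Sum>i = 0..<int (2 * Q). of_real ((if int P dvd i - l - j then 1 else 0) / Q))" for l
      unfolding n_def by (subst sum_divide_distrib, subst of_real_sum, rule refl)
    then show ?thesis
      by (subst sum_divide_distrib, subst of_real_sum) (rule sum.cong, simp_all only:)
  qed
  finally have eq: "(\<Sum>t = 0..<int P. trapezoid_kernel P Q t * unit_char (- (of_int j * of_int t / P)))
      = of_real ((\<Sum>l = 0..<int Q. n l) / Q)" .
  have n_le: "n l \<le> 1" for l
  proof -
    define m where "m = (l + j) mod int P"
    have "n l \<le> (\<Sum>i = 0..<int (2 * Q). if i = m then 1 else 0)"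
      unfolding n_def
    proof (rule sum_mono)
      fix i assume "i \<in> {0..<int (2 * Q)}"
      then have "i mod int P = i"
        using assms by simp
      then have "int P dvd i - l - j \<longleftrightarrow> i = m"
        using mod_eq_dvd_iff[of i "int P" "l + j"] by (simp add: m_def diff_diff_add)
      then show "(if int P dvd i - l - j then 1 else 0 :: real) \<le> (if i = m then 1 else 0)"
        by auto
    qed
    also have "\<dots> \<le> 1"
      by simp
    finally show ?thesis .
  qed
  have n_ge: "n l \<ge> 1" if "j < int Q" "l \<in> {0..<int Q}" for l
  proof -
    have "(\<Sum>i \<in> {l + j}. if int P dvd i - l - j then 1 else 0 :: real) \<le> n l"
      unfolding n_def using that assms by (intro sum_mono2) auto
    then show ?thesis
      by simp
  qed
  have "(\<Sum>l = 0..<int Q. n l) \<le> (\<Sum>l = 0..<int Q. 1)"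
    by (intro sum_mono n_le)
  then have le: "(\<Sum>l = 0..<int Q. n l) / Q \<le> 1"
    using assms by (simp add: field_simps)
  show ?thesis
  proof (rule that[OF eq])
    show "0 \<le> (\<Sum>l = 0..<int Q. n l) / Q"
      by (intro divide_nonneg_nonneg sum_nonneg) (auto simp: n_def intro!: sum_nonneg)
    show "(\<Sum>l = 0..<int Q. n l) / Q \<le> 1"
      by (rule le)
    assume "j < int Q"
    then have "n l = 1" if "l \<in> {0..<int Q}" for l
      using n_le[of l] n_ge[of l] that by simp
    then show "(\<Sum>l = 0..<int Q. n l) / Q = 1"
      using assms by simp
  qed
qed

text \<open>The error term is the convolution remainder \<open>v - v * K\<close> for the trapezoid kernel \<open>K\<close>.\<close>

lemma smooth_approximation:
  fixes v c :: "int \<Rightarrow> complex"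
  assumes "Q > 0" "2 * Q \<le> P"
    and v: "\<And>t. v t = (\<Sum>j = 0..<int P. c j * unit_char (of_int j * of_int t / P))"
    and bound: "\<And>t. cmod (v t) \<le> 1"
  obtains T :: "int \<Rightarrow> complex" where
    "(\<Sum>t = 0..<int P. (cmod (T t))\<^sup>2) \<le> P * (\<Sum>j = int Q..<int P. (cmod (c j))\<^sup>2)"
    "\<And>t. T (t + int P) = T t"
    "\<And>t h. h \<ge> 0 \<Longrightarrow> cmod (v (t + h) - v t) \<le> 2 * pi * of_int h / P * (5 / 2 * Q) + cmod (T (t + h)) + cmod (T t)"
proof -
  have P: "P > 0"
    using assms by auto
  let ?e = "\<lambda>j t. unit_char (of_int j * of_int t / P)"
  let ?K = "trapezoid_kernel P Q"
  \<comment> \<open>\<open>K'\<close> lists the Fourier coefficients of the kernel, so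
    \<open>T\<close> is \<open>v\<close> with the multiplier \<open>1 - K'\<close>. This multiplier
    vanishes below \<open>Q\<close> and lies between 0 and 1 elsewhere, so that by Parseval only the
    tail of \<open>c\<close> contributes to the energy of \<open>T\<close>.\<close>
  define K' where "K' j = (\<Sum>k = 0..<int P. ?K k * unit_char (- (of_int j * of_int k / P)))" for j
  define T where "T t = (\<Sum>j = 0..<int P. c j * (1 - K' j) * ?e j t)" for t
  have v_per: "v (t + int P) = v t" for t
    unfolding v by (simp only: unit_char_shift_period[OF P])
  have conv: "(\<Sum>k = 0..<int P. v (t - k) * ?K k) = v t - T t" for t
  proof -
    have e: "?e j (t - k) = ?e j t * unit_char (- (of_int j * of_int k / P))" for j k
      by (simp add: right_diff_distrib diff_divide_distrib flip: unit_char_add)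
    have "(\<Sum>k = 0..<int P. v (t - k) * ?K k)
        = (\<Sum>k = 0..<int P. \<Sum>j = 0..<int P. c j * ?e j t * (?K k * unit_char (- (of_int j * of_int k / P))))"
      unfolding v e sum_distrib_right by (intro sum.cong refl) (simp only: mult_ac)
    also have "\<dots> = (\<Sum>j = 0..<int P. \<Sum>k = 0..<int P. c j * ?e j t * (?K k * unit_char (- (of_int j * of_int k / P))))"
      by (rule sum.swap)
    also have "\<dots> = (\<Sum>j = 0..<int P. c j * ?e j t * K' j)"
      by (simp only: K'_def sum_distrib_left)
    also have "\<dots> = v t - T t"
      unfolding v T_def sum_subtractf[symmetric] by (intro sum.cong refl) (simp add: algebra_simps)
    finally show ?thesis .
  qed
  \<comment> \<open>Reindexing moves the variable \<open>t\<close> from \<open>v\<close> onto the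
    kernel. Increments of \<open>v - T\<close> then involve only increments of \<open>?K\<close>,
    weighted by values of \<open>v\<close> of modulus at most 1.\<close>
  have conv': "(\<Sum>k = 0..<int P. v (- k) * ?K (t + k)) = v t - T t" for t
  proof -
    have "(\<Sum>k = 0..<int P. (\<lambda>k. v (t - k) * ?K k) (k + t)) = (\<Sum>k = 0..<int P. v (t - k) * ?K k)"
    proof (rule sum_periodic_shift)
      fix k
      show "v (t - (k + int P)) * ?K (k + int P) = v (t - k) * ?K k"
        using v_per[of "t - k - int P"] by (simp add: trapezoid_kernel_periodic[OF P] algebra_simps)
    qed
    then show ?thesis
      by (simp add: conv add.commute)
  qed
  show ?thesis
  proof (rule that[of T])
    show "T (t + int P) = T t" for t
      unfolding T_def by (simp only: unit_char_shift_period[OF P])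
    have "(\<Sum>t = 0..<int P. (cmod (T t))\<^sup>2) = P * (\<Sum>j = 0..<int P. (cmod (c j * (1 - K' j)))\<^sup>2)"
      unfolding T_def using parseval[OF P, of "{0..<int P}"] by simp
    also have "(\<Sum>j = 0..<int P. (cmod (c j * (1 - K' j)))\<^sup>2) = (\<Sum>j = int Q..<int P. (cmod (c j * (1 - K' j)))\<^sup>2)"
    proof (rule sum.mono_neutral_right)
      show "\<forall>j\<in>{0..<int P} - {int Q..<int P}. (cmod (c j * (1 - K' j)))\<^sup>2 = 0"
      proof
        fix j assume j: "j \<in> {0..<int P} - {int Q..<int P}"
        then have "j \<in> {0..<int P}" by simp
        then obtain r :: real where "K' j = r" "j < int Q \<Longrightarrow> r = 1"
          unfolding K'_def using trapezoid_kernel_coeff[OF assms(1,2)] by metis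
        then show "(cmod (c j * (1 - K' j)))\<^sup>2 = 0"
          using j by auto
      qed
    qed auto
    also have "\<dots> \<le> (\<Sum>j = int Q..<int P. (cmod (c j))\<^sup>2)"
    proof (rule sum_mono)
      fix j assume "j \<in> {int Q..<int P}"
      then have "j \<in> {0..<int P}" by simp
      then obtain r :: real where r: "K' j = r" "0 \<le> r" "r \<le> 1"
        unfolding K'_def using trapezoid_kernel_coeff[OF assms(1,2)] by metis
      then have "cmod (1 - K' j) = 1 - r"
        by (metis abs_of_nonneg diff_ge_0_iff_ge norm_of_real of_real_1 of_real_diff)
      then have "cmod (c j * (1 - K' j)) \<le> cmod (c j)"
        using r by (simp add: norm_mult mult_left_le)
      then show "(cmod (c j * (1 - K' j)))\<^sup>2 \<le> (cmod (c j))\<^sup>2"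
        by (simp add: power_mono)
    qed
    finally show "(\<Sum>t = 0..<int P. (cmod (T t))\<^sup>2) \<le> P * (\<Sum>j = int Q..<int P. (cmod (c j))\<^sup>2)"
      by (simp add: mult_left_mono)
    fix t h :: int assume h: "h \<ge> 0"
    have "(v (t + h) - T (t + h)) - (v t - T t) = (\<Sum>k = 0..<int P. v (- k) * (?K (k + t + h) - ?K (k + t)))"
      unfolding conv'[symmetric] sum_subtractf[symmetric]
      by (intro sum.cong refl) (simp add: right_diff_distrib ac_simps)
    also have "cmod \<dots> \<le> (\<Sum>k = 0..<int P. cmod (?K (k + t + h) - ?K (k + t)))"
      by (intro sum_norm_le) (simp add: norm_mult mult_left_le_one_le bound)
    also have "\<dots> = (\<Sum>k = 0..<int P. cmod (?K (k + h) - ?K k))"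
    proof -
      have "?K (k + int P + h) = ?K (k + h)" for k
        using trapezoid_kernel_periodic[OF P, of Q "k + h"] by (simp add: ac_simps)
      then have "cmod (?K (k + int P + h) - ?K (k + int P)) = cmod (?K (k + h) - ?K k)" for k
        by (simp only: trapezoid_kernel_periodic[OF P])
      then show ?thesis
        by (rule sum_periodic_shift)
    qed
    also have "\<dots> \<le> 2 * pi * h / P * (5 / 2 * Q)"
      by (rule trapezoid_kernel_diff_norm[OF assms(1,2) h])
    finally have "cmod ((v (t + h) - v t) - (T (t + h) - T t)) \<le> 2 * pi * h / P * (5 / 2 * Q)"
      by (simp add: algebra_simps)
    then show "cmod (v (t + h) - v t) \<le> 2 * pi * of_int h / P * (5 / 2 * Q) + cmod (T (t + h)) + cmod (T t)"
      using norm_triangle_ineq2[of "v (t + h) - v t" "T (t + h) - T t"] norm_triangle_ineq4[of "T (t + h)" "T t"]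
      by linarith
  qed
qed

section \<open>The Zak transform\<close>

definition zak :: "nat \<Rightarrow> nat \<Rightarrow> (int \<Rightarrow> complex) \<Rightarrow> int \<Rightarrow> int \<Rightarrow> complex" where
  "zak M N b m n = (\<Sum>j = 0..<int N. b (m + int M * j) * unit_char (of_int j * of_int n / N))"

lemma zak_periodic: "N > 0 \<Longrightarrow> zak M N b m (n + int N) = zak M N b m n"
  unfolding zak_def by (simp only: unit_char_shift_period)

lemma l2_space_periodic: "b \<in> l2_space M N \<Longrightarrow> b (j + int M * int N) = b j"
  by (simp add: l2_space_def)

text \<open>Replacing \<open>m\<close> by \<open>m + M\<close> amounts to shifting the summation
  index by one. Over a full period the shift is harmless, and only the phase of one step
  remains.\<close>

lemma zak_quasiperiodic:
  assumes "b \<in> l2_space M N" "N > 0"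
  shows "zak M N b (m + int M) n = unit_char (- (of_int n / N)) * zak M N b m n"
proof -
  define f where "f j = b (m + int M * j) * unit_char (of_int j * of_int n / N)" for j
  have "f (j + int N) = f j" for j
    unfolding f_def using l2_space_periodic[OF assms(1), of "m + int M * j"] assms(2)
      unit_char_shift_period[of N n j] by (simp add: ring_distribs ac_simps)
  then have "(\<Sum>j = 0..<int N. f (j + 1)) = (\<Sum>j = 0..<int N. f j)"
    by (rule sum_periodic_shift)
  moreover have "f (j + 1) = unit_char (of_int n / N) * (b (m + int M + int M * j) * unit_char (of_int j * of_int n / N))" for j
    by (simp add: f_def ring_distribs add_divide_distrib unit_char_add ac_simps)
  ultimately have "unit_char (of_int n / N) * zak M N b (m + int M) n = zak M N b m n"
    unfolding zak_def f_def[symmetric] by (simp add: sum_distrib_left)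
  then have "unit_char (- (of_int n / N)) * (unit_char (of_int n / N) * zak M N b (m + int M) n)
      = unit_char (- (of_int n / N)) * zak M N b m n"
    by simp
  then show ?thesis
    by (simp flip: mult.assoc unit_char_add)
qed

lemma finite_fourier_eq:
  "finite_fourier M N b k = 1 / of_nat M *
    (\<Sum>j = 0..<int (M * N). b j * unit_char (- (of_int j * of_int k / (real M * real N))))"
  by (simp add: finite_fourier_def unit_char_eq_exp mult_ac)

text \<open>
  Poisson summation: the Fourier transform of \<open>b\<close> has, up to a rotation and a quarter turn of the
  phase plane, the same Zak transform.
\<close>

lemma zak_finite_fourier:
  assumes "b \<in> l2_space M N" "M > 0" "N > 0"
  shows "zak M N b m (- n) = unit_char (of_int m * of_int n / (real M * real N)) * zak N M (finite_fourier M N b) n m"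
proof -
  \<comment> \<open>Summing over \<open>l\<close> first leaves only the \<open>j\<close> in the
    residue class of \<open>m\<close> modulo \<open>M\<close>; the factor \<open>M\<close> produced
    by that sum cancels the normalisation of the Fourier transform.\<close>
  define g where "g j = (if int M dvd m - j then b j * unit_char (- (of_int j * of_int n / (real M * real N))) else 0)" for j
  have g_per: "g (j + int (M * N)) = g j" for j
  proof -
    have "int M dvd m - (j + int (M * N)) \<longleftrightarrow> int M dvd m - j"
    proof -
      have "m - (j + int (M * N)) = m - j - int M * int N"
        by simp
      then show ?thesis
        by (simp only: dvd_diff_left_iff dvd_triv_left)
    qed
    moreover have "unit_char (- (of_int (j + int (M * N)) * of_int n / (real M * real N)))
        = unit_char (- (of_int j * of_int n / (real M * real N)))"
    proof -
      have "- (of_int (j + int (M * N)) * of_int n / (real M * real N))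
          = - (of_int j * of_int n / (real M * real N)) + of_int (- n)"
        using assms by (simp add: field_simps)
      then show ?thesis
        by (simp only: unit_char_add unit_char_of_int mult_1_right)
    qed
    ultimately show ?thesis
      using l2_space_periodic[OF assms(1), of j] by (simp add: g_def)
  qed
  have "zak N M (finite_fourier M N b) n m
      = (\<Sum>l = 0..<int M. \<Sum>j = 0..<int (M * N). 1 / of_nat M * (b j * unit_char (- (of_int j * of_int n / (real M * real N))))
          * unit_char (of_int (m - j) * of_int l / M))"
    unfolding zak_def
  proof (rule sum.cong[OF refl])
    fix l
    have "unit_char (- (of_int j * of_int (n + int N * l) / (real M * real N))) * unit_char (of_int l * of_int m / M)
        = unit_char (- (of_int j * of_int n / (real M * real N))) * unit_char (of_int (m - j) * of_int l / M)" for j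
    proof -
      have "- (of_int j * of_int (n + int N * l) / (real M * real N)) + of_int l * of_int m / M
          = - (of_int j * of_int n / (real M * real N)) + of_int (m - j) * of_int l / M"
        using assms by (simp add: field_simps)
      then show ?thesis
        by (simp only: unit_char_add[symmetric])
    qed
    then show "finite_fourier M N b (n + int N * l) * unit_char (of_int l * of_int m / M)
        = (\<Sum>j = 0..<int (M * N). 1 / of_nat M * (b j * unit_char (- (of_int j * of_int n / (real M * real N))))
          * unit_char (of_int (m - j) * of_int l / M))"
      unfolding finite_fourier_eq sum_distrib_left sum_distrib_right
      by (intro sum.cong refl) (simp only: mult.assoc)
  qed
  also have "\<dots> = (\<Sum>j = 0..<int (M * N). \<Sum>l = 0..<int M. 1 / of_nat M * (b j * unit_char (- (of_int j * of_int n / (real M * real N))))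
          * unit_char (of_int (m - j) * of_int l / M))"
    by (rule sum.swap)
  also have "\<dots> = (\<Sum>j = 0..<int (M * N). g j)"
    unfolding sum_distrib_left[symmetric] sum_unit_char[OF assms(2)] g_def
    using assms by (intro sum.cong refl) simp
  \<comment> \<open>Shifting by \<open>m\<close> moves the surviving class to the multiples of
    \<open>M\<close>, so after splitting by residues only \<open>r = 0\<close> contributes.\<close>
  also have "\<dots> = (\<Sum>j = 0..<int (M * N). g (j + m))"
    by (rule sum_periodic_shift[symmetric]) (rule g_per)
  also have "\<dots> = (\<Sum>r = 0..<int M. \<Sum>t = 0..<int N. g (r + int M * t + m))"
    using sum_split_residues[of "int M" "\<lambda>j. g (j + m)" 0 "int N"] assms by simp
  also have "\<dots> = (\<Sum>r \<in> {0}. \<Sum>t = 0..<int N. g (r + int M * t + m))"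
  proof (rule sum.mono_neutral_right)
    have "g (r + int M * t + m) = 0" if r: "r \<in> {0..<int M} - {0}" for r t
    proof -
      have "int M dvd m - (r + int M * t + m) \<longleftrightarrow> int M dvd r"
        using dvd_minus_iff[of "int M" "r + int M * t"] by (simp add: dvd_add_left_iff)
      then have "\<not> int M dvd m - (r + int M * t + m)"
        using r zdvd_not_zless[of r "int M"] by simp
      then show ?thesis
        by (simp add: g_def)
    qed
    then show "\<forall>r\<in>{0..<int M} - {0}. (\<Sum>t = 0..<int N. g (r + int M * t + m)) = 0"
      by simp
  qed (use assms in auto)
  also have "\<dots> = (\<Sum>t = 0..<int N. unit_char (- (of_int m * of_int n / (real M * real N))) *
      (b (m + int M * t) * unit_char (of_int t * of_int (- n) / N)))"
  proof -
    have "unit_char (- (of_int (int M * t + m) * of_int n / (real M * real N)))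
        = unit_char (- (of_int m * of_int n / (real M * real N))) * unit_char (of_int t * of_int (- n) / N)" for t
    proof -
      have "- (of_int (int M * t + m) * of_int n / (real M * real N))
          = - (of_int m * of_int n / (real M * real N)) + of_int t * of_int (- n) / N"
        using assms by (simp add: field_simps)
      then show ?thesis
        by (simp only: unit_char_add)
    qed
    then show ?thesis
      by (simp add: g_def add.commute mult_ac)
  qed
  also have "\<dots> = unit_char (- (of_int m * of_int n / (real M * real N))) * zak M N b m (- n)"
    by (simp only: zak_def sum_distrib_left)
  finally have "unit_char (of_int m * of_int n / (real M * real N)) * zak N M (finite_fourier M N b) n m
      = unit_char (of_int m * of_int n / (real M * real N)) * unit_char (- (of_int m * of_int n / (real M * real N))) * zak M N b m (- n)"
    by simp
  then show ?thesis
    by (simp flip: unit_char_add)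
qed

section \<open>From Gabor orthonormality to a unimodular Zak transform\<close>

lemma gabor_index_memI:
  assumes "k \<in> {0..<int N}" "l \<in> {0..<int M}"
  shows "(int M * k, int N * l) \<in> gabor_index M N"
proof -
  have "int M * k < int M * int N" "int N * l < int N * int M"
    using assms by auto
  then have "int M * k = int M * k mod int (M * N)" "int N * l = int N * l mod int (M * N)"
    using assms by (simp_all add: mult.commute)
  then show ?thesis
    unfolding gabor_index_def multiples_mod_def by blast
qed

text \<open>A modulation by a multiple \<open>N * l\<close> has phase \<open>l * j / M\<close>,
  which sees only \<open>j\<close> modulo \<open>M\<close>. The inner product of a shifted and
  modulated element with \<open>b\<close> is therefore, up to a factor, the Fourier coefficient at
  \<open>l\<close> of the autocorrelation \<open>c\<close> on residues. Orthonormality prescribes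
  all these coefficients.\<close>

lemma gabor_autocorrelation:
  assumes "M > 0" "N > 0"
    and onb: "l2_orthonormal_basis M N (gabor_index M N) (gabor M N b)"
    and k: "k \<in> {0..<int N}" and m: "m \<in> {0..<int M}"
  shows "(\<Sum>t = 0..<int N. b (m + int M * (t - k)) * cnj (b (m + int M * t))) = (if k = 0 then 1 else 0)"
proof -
  define c where "c r = (\<Sum>t = 0..<int N. b (r + int M * (t - k)) * cnj (b (r + int M * t)))" for r
  have coeff: "(\<Sum>r = 0..<int M. c r * unit_char (of_int l * of_int r / M)) = (if k = 0 \<and> l = 0 then of_nat M else 0)"
    if l: "l \<in> {0..<int M}" for l
  proof -
    have gab: "gabor M N b (int M * k, int N * l) j * cnj (gabor M N b (0, 0) j)
        = b (j - int M * k) * cnj (b j) * unit_char (of_int l * of_int j / M)" for j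
      using assms by (simp add: gabor_def unit_char_eq_exp mult_ac)
    have zero: "(0, 0) \<in> gabor_index M N"
      using gabor_index_memI[of 0 N 0 M] assms by simp
    have "l2_inner M N (gabor M N b (int M * k, int N * l)) (gabor M N b (0, 0))
        = (if k = 0 \<and> l = 0 then 1 else 0)"
      using onb zero gabor_index_memI[OF k l] assms unfolding l2_orthonormal_basis_def by auto
    then have "(\<Sum>j = 0..<int (M * N). b (j - int M * k) * cnj (b j) * unit_char (of_int l * of_int j / M))
        = (if k = 0 \<and> l = 0 then of_nat M else 0)"
      using assms unfolding l2_inner_def gab by (auto simp: field_simps split: if_splits)
    also have "(\<Sum>j = 0..<int (M * N). b (j - int M * k) * cnj (b j) * unit_char (of_int l * of_int j / M))
        = (\<Sum>r = 0..<int M. \<Sum>t = 0..<int N. b (r + int M * t - int M * k) * cnj (b (r + int M * t)) *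
            unit_char (of_int l * of_int (r + int M * t) / M))"
      using sum_split_residues[of "int M" "\<lambda>j. b (j - int M * k) * cnj (b j) * unit_char (of_int l * of_int j / M)" 0 "int N"]
        assms by simp
    also have "\<dots> = (\<Sum>r = 0..<int M. c r * unit_char (of_int l * of_int r / M))"
    proof -
      have "unit_char (of_int l * of_int (r + int M * t) / M) = unit_char (of_int l * of_int r / M)" for r t
      proof -
        have "of_int l * of_int (r + int M * t) / M = of_int l * of_int r / real M + of_int (l * t)"
          using assms by (simp add: field_simps)
        then show ?thesis
          by (simp only: unit_char_add unit_char_of_int mult_1_right)
      qed
      then show ?thesis
        by (simp add: c_def sum_distrib_right right_diff_distrib add_diff_eq)
    qed
    finally show ?thesis .
  qed
  \<comment> \<open>Fourier inversion modulo \<open>M\<close>: the point mass at \<open>m\<close> is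
    written as a sum of characters.\<close>
  have "of_nat M * c m = (\<Sum>r = 0..<int M. c r * (if int M dvd r - m then of_nat M else 0))"
  proof -
    have "(\<Sum>r = 0..<int M. c r * (if int M dvd r - m then of_nat M else 0))
        = (\<Sum>r = 0..<int M. if r = m then c r * of_nat M else 0)"
      using dvd_diff_residues[OF _ m] by (intro sum.cong) auto
    then show ?thesis
      using m by simp
  qed
  also have "\<dots> = (\<Sum>r = 0..<int M. \<Sum>l = 0..<int M. c r * unit_char (of_int (r - m) * of_int l / M))"
    by (simp only: sum_unit_char[OF assms(1)] flip: sum_distrib_left)
  also have "\<dots> = (\<Sum>l = 0..<int M. \<Sum>r = 0..<int M. c r * unit_char (of_int (r - m) * of_int l / M))"
    by (rule sum.swap)
  also have "\<dots> = (\<Sum>l = 0..<int M. (\<Sum>r = 0..<int M. c r * unit_char (of_int l * of_int r / M)) * unit_char (- (of_int l * of_int m / M)))"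
  proof -
    have "unit_char (of_int (r - m) * of_int l / M) = unit_char (of_int l * of_int r / M) * unit_char (- (of_int l * of_int m / M))" for r l
      by (simp add: left_diff_distrib right_diff_distrib diff_divide_distrib mult.commute flip: unit_char_add)
    then show ?thesis
      by (simp only: sum_distrib_right mult.assoc)
  qed
  also have "\<dots> = (\<Sum>l = 0..<int M. (if k = 0 \<and> l = 0 then of_nat M else 0) * unit_char (- (of_int l * of_int m / M)))"
    using coeff by (intro sum.cong refl) simp
  also have "\<dots> = (\<Sum>l = 0..<int M. if l = 0 then (if k = 0 then of_nat M else 0) else 0)"
    by (intro sum.cong) auto
  also have "\<dots> = of_nat M * (if k = 0 then 1 else 0)"
    using assms by simp
  finally show ?thesis
    using assms unfolding c_def by (simp only: mult_cancel_left) simp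
qed

text \<open>The squared modulus is the discrete Fourier transform, in the lag \<open>k\<close>, of
  the autocorrelation along a coset. The latter is the point mass at lag 0, whose transform is the
  constant 1.\<close>

lemma zak_unimodular:
  assumes "M > 0" "N > 0" "b \<in> l2_space M N"
    and onb: "l2_orthonormal_basis M N (gabor_index M N) (gabor M N b)"
  shows "cmod (zak M N b m n) = 1"
proof -
  have base: "cmod (zak M N b m n) = 1" if m: "m \<in> {0..<int M}" for m
  proof -
    let ?e = "\<lambda>j. unit_char (of_int j * of_int n / N)"
    have "complex_of_real ((cmod (zak M N b m n))\<^sup>2) = zak M N b m n * cnj (zak M N b m n)"
      by (rule complex_norm_square)
    also have "\<dots> = (\<Sum>t = 0..<int N. \<Sum>s = 0..<int N. b (m + int M * s) * cnj (b (m + int M * t)) * ?e (s - t))"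
    proof -
      have "b (m + int M * s) * ?e s * cnj (b (m + int M * t) * ?e t)
          = b (m + int M * s) * cnj (b (m + int M * t)) * ?e (s - t)" for s t
      proof -
        have "?e s * cnj (?e t) = ?e (s - t)"
          by (simp add: cnj_unit_char left_diff_distrib diff_divide_distrib flip: unit_char_add)
        then show ?thesis
          by (simp add: mult_ac)
      qed
      then show ?thesis
        unfolding zak_def cnj_sum sum_product by (simp only:) (rule sum.swap)
    qed
    also have "\<dots> = (\<Sum>t = 0..<int N. \<Sum>k = 0..<int N. b (m + int M * (t - k)) * cnj (b (m + int M * t)) * ?e (- k))"
    proof (rule sum.cong[OF refl])
      fix t
      define f where "f s = b (m + int M * s) * cnj (b (m + int M * t)) * ?e (s - t)" for s
      have "f (s + int N) = f s" for s
      proof -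
        have "of_int (s + int N - t) * of_int n / real N = of_int (s - t) * of_int n / real N + of_int n"
          using assms(2) by (simp add: field_simps)
        then have "?e (s + int N - t) = ?e (s - t)"
          by (simp only: unit_char_add unit_char_of_int mult_1_right)
        moreover have "b (m + int M * (s + int N)) = b (m + int M * s)"
          using l2_space_periodic[OF assms(3), of "m + int M * s"] by (simp add: ring_distribs ac_simps)
        ultimately show ?thesis
          by (simp only: f_def)
      qed
      then have "(\<Sum>k = 0..<int N. f (t - k)) = (\<Sum>s = 0..<int N. f s)"
        by (rule sum_periodic_reflect)
      then show "(\<Sum>s = 0..<int N. b (m + int M * s) * cnj (b (m + int M * t)) * ?e (s - t))
          = (\<Sum>k = 0..<int N. b (m + int M * (t - k)) * cnj (b (m + int M * t)) * ?e (- k))"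
        by (simp add: f_def)
    qed
    also have "\<dots> = (\<Sum>k = 0..<int N. (\<Sum>t = 0..<int N. b (m + int M * (t - k)) * cnj (b (m + int M * t))) * ?e (- k))"
      unfolding sum_distrib_right by (rule sum.swap)
    also have "\<dots> = (\<Sum>k = 0..<int N. (if k = 0 then 1 else 0) * ?e (- k))"
      using gabor_autocorrelation[OF assms(1,2) onb _ m] by (intro sum.cong refl) simp
    also have "\<dots> = (\<Sum>k = 0..<int N. if k = 0 then 1 else 0)"
      by (intro sum.cong) auto
    also have "\<dots> = 1"
      using assms by simp
    finally have "(cmod (zak M N b m n))\<^sup>2 = 1"
      using of_real_eq_1_iff by blast
    then show ?thesis
      by (simp add: power2_eq_1_iff) (metis norm_ge_zero not_one_le_zero neg_0_le_iff_le)
  qed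
  \<comment> \<open>Quasi-periodicity affects only the phase, so the modulus is periodic in
    \<open>m\<close> and the case of reduced residues suffices.\<close>
  have "cmod (zak M N b (m mod int M) n) = cmod (zak M N b m n)"
    using zak_quasiperiodic[OF assms(3,2)]
    by (intro periodic_mod[of "\<lambda>m. cmod (zak M N b m n)"]) (simp add: norm_mult)
  then show ?thesis
    using base[of "m mod int M"] assms by simp
qed

text \<open>Smoothing is applied separately for each \<open>m\<close>, and the tails of the cosets
  add up to the tail of \<open>b\<close>. It serves twice: for \<open>b\<close>, and for its Fourier
  transform with \<open>M\<close> and \<open>N\<close> exchanged.\<close>

lemma zak_smooth_approximation:
  assumes "M > 0" "Q > 0" "2 * Q \<le> N" and bound: "\<And>m n. cmod (zak M N b m n) \<le> 1"
  obtains T :: "int \<Rightarrow> int \<Rightarrow> complex" where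
    "(\<Sum>m = 0..<int M. \<Sum>t = 0..<int N. (cmod (T m t))\<^sup>2) \<le> N * (\<Sum>j = int (M * Q)..<int (M * N). (cmod (b j))\<^sup>2)"
    "\<And>m t. T m (t + int N) = T m t"
    "\<And>m t h. h \<ge> 0 \<Longrightarrow> cmod (zak M N b m (t + h) - zak M N b m t)
        \<le> 2 * pi * of_int h / N * (5 / 2 * Q) + cmod (T m (t + h)) + cmod (T m t)"
proof -
  define approx where "approx m T \<longleftrightarrow>
      (\<Sum>t = 0..<int N. (cmod (T t))\<^sup>2) \<le> N * (\<Sum>j = int Q..<int N. (cmod (b (m + int M * j)))\<^sup>2) \<and>
      (\<forall>t. T (t + int N) = T t) \<and>
      (\<forall>t h. h \<ge> 0 \<longrightarrow> cmod (zak M N b m (t + h) - zak M N b m t)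
        \<le> 2 * pi * of_int h / N * (5 / 2 * Q) + cmod (T (t + h)) + cmod (T t))"
    for m and T :: "int \<Rightarrow> complex"
  have "\<exists>T. approx m T" for m
  proof (rule smooth_approximation[OF assms(2,3), of "zak M N b m" "\<lambda>j. b (m + int M * j)"])
    show "zak M N b m t = (\<Sum>j = 0..<int N. b (m + int M * j) * unit_char (of_int j * of_int t / N))" for t
      by (rule zak_def)
  qed (auto simp: approx_def bound)
  then obtain T where "\<And>m. approx m (T m)"
    by metis
  then have T:
    "\<And>m. (\<Sum>t = 0..<int N. (cmod (T m t))\<^sup>2) \<le> N * (\<Sum>j = int Q..<int N. (cmod (b (m + int M * j)))\<^sup>2)"
    "\<And>m t. T m (t + int N) = T m t"
    "\<And>m t h. h \<ge> 0 \<Longrightarrow> cmod (zak M N b m (t + h) - zak M N b m t)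
        \<le> 2 * pi * of_int h / N * (5 / 2 * Q) + cmod (T m (t + h)) + cmod (T m t)"
    unfolding approx_def by simp_all
  show ?thesis
  proof (rule that[OF _ T(2,3)])
    have "(\<Sum>m = 0..<int M. \<Sum>t = 0..<int N. (cmod (T m t))\<^sup>2)
        \<le> (\<Sum>m = 0..<int M. N * (\<Sum>j = int Q..<int N. (cmod (b (m + int M * j)))\<^sup>2))"
      by (intro sum_mono T)
    also have "\<dots> = N * (\<Sum>j = int (M * Q)..<int (M * N). (cmod (b j))\<^sup>2)"
      using sum_split_residues[of "int M" "\<lambda>j. (cmod (b j))\<^sup>2" "int Q" "int N"] assms
      by (simp add: sum_distrib_left)
    finally show "(\<Sum>m = 0..<int M. \<Sum>t = 0..<int N. (cmod (T m t))\<^sup>2) \<le> N * (\<Sum>j = int (M * Q)..<int (M * N). (cmod (b j))\<^sup>2)" .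
  qed
qed

section \<open>The uncertainty bound\<close>

text \<open>For a unit vector \<open>q\<close>, the square of \<open>cmod (q - 1)\<close> is
  \<open>2 - 2 * Re q\<close>, so any chord shorter than the square root of 2 suffices.\<close>

lemma Re_quotient_pos:
  assumes "cmod z = 1" "cmod w = 1" "cmod (w - z) \<le> 1.4"
  shows "Re (w / z) > 0"
proof -
  define q where "q = w / z"
  have q: "cmod q = 1"
    using assms by (simp add: q_def norm_divide)
  have "z \<noteq> 0"
    using assms by auto
  then have "q - 1 = (w - z) / z"
    by (simp add: q_def diff_divide_distrib)
  then have "cmod (q - 1) \<le> 1.4"
    using assms by (simp add: norm_divide)
  then have "(cmod (q - 1))\<^sup>2 \<le> 1.4\<^sup>2"
    by (intro power_mono) auto
  moreover have "(cmod (q - 1))\<^sup>2 = (cmod q)\<^sup>2 + 1 - 2 * Re q"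
    unfolding cmod_power2 by (simp add: power2_eq_square algebra_simps)
  ultimately have "2 * Re q \<ge> 2 - 1.4\<^sup>2"
    using q by simp
  then show ?thesis
    by (simp add: q_def power2_eq_square)
qed

lemma norm_diff_rotated_le:
  fixes u v z w :: complex
  assumes "cmod u = 1" "cmod z \<le> 1"
  shows "cmod (u * w - v * z) \<le> cmod (u - v) + cmod (w - z)"
proof -
  have "u * w - v * z = (u - v) * z + u * (w - z)"
    by (simp add: algebra_simps)
  also have "cmod \<dots> \<le> cmod (u - v) * cmod z + cmod u * cmod (w - z)"
    by (metis norm_mult norm_triangle_ineq)
  also have "\<dots> \<le> cmod (u - v) + cmod (w - z)"
    using assms by (simp add: mult_left_le)
  finally show ?thesis .
qed

text \<open>The first summand pays for a rotating phase factor, the second for the smooth part. The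
  total is at most 2 pi (1/16 + 5/32) = 7 pi/16 < 1.38, which leaves 0.02 of the allowed jump 1.4
  for the two error values.\<close>

lemma jump_budget:
  assumes "S > 0" "P > 0" "16 * int S * h \<le> int P"
  shows "2 * pi * of_int h / real P + 2 * pi * of_int h / real P * (5 / 2 * S) \<le> 1.38"
proof -
  define r where "r = of_int h * real S / P"
  have "real_of_int (16 * int S * h) \<le> real_of_int (int P)"
    using assms by (simp only: of_int_le_iff)
  then have r: "r \<le> 1 / 16"
    using assms by (simp add: r_def field_simps)
  have hr: "of_int h / real P = r / S"
    using assms by (simp add: r_def)
  have "r / S \<le> 1 / 16"
  proof (cases "r \<ge> 0")
    case True
    then have "r / S \<le> r / 1"
      using assms by (intro divide_left_mono) auto
    then show ?thesis
      using r by linarith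
  next
    case False
    then have "r / S \<le> 0"
      by (simp add: divide_nonpos_nonneg)
    then show ?thesis
      by linarith
  qed
  then have "r / S + 5 / 2 * r \<le> 7 / 32"
    using r by linarith
  then have "2 * pi * (r / S + 5 / 2 * r) \<le> 2 * pi * (7 / 32)"
    by (intro mult_left_mono) auto
  also have "\<dots> \<le> 1.38"
    using pi_approx by simp
  also have "2 * pi * (r / S + 5 / 2 * r) = 2 * pi * (of_int h / real P) + 2 * pi * (of_int h / real P) * (5 / 2 * S)"
    using assms unfolding hr by (simp add: algebra_simps)
  finally show ?thesis
    by simp
qed

section \<open>A coarse grid and a good translate of it\<close>

lemma coarse_partition:
  fixes S P :: nat
  assumes "S > 0" "16 * S \<le> P"
  obtains I :: nat and x :: "nat \<Rightarrow> int" where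
    "x 0 = 0" "x I = int P" "\<And>i. 0 \<le> x i \<and> x i \<le> int P" "\<And>i. x i \<le> x (Suc i)"
    "\<And>i. 16 * int S * (x (Suc i) - x i) \<le> int P" "Suc I \<le> 34 * S"
proof -
  define h where "h = P div (16 * S)"
  \<comment> \<open>The extra step lets \<open>I * h\<close> reach \<open>P\<close> even when
    \<open>h\<close> does not divide \<open>P\<close>; the minimum in \<open>x\<close> then cuts the
    last steps off at \<open>P\<close>.\<close>
  define I where "I = P div h + 1"
  define x where "x i = int (min (i * h) P)" for i
  have h: "h > 0"
    using assms by (simp add: h_def div_greater_zero_iff)
  have h_le: "16 * S * h \<le> P"
    by (simp add: h_def)
  \<comment> \<open>Rounding \<open>h\<close> down loses at most a factor 2 because
    \<open>h \<ge> 1\<close>, so fewer than \<open>32 * S\<close> whole steps fit into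
    \<open>P\<close>.\<close>
  have "P < 16 * S * (h + 1)"
    using assms by (simp add: h_def dividend_less_times_div)
  also have "\<dots> \<le> 16 * S * (2 * h)"
    using h by (intro mult_left_mono) auto
  finally have "P < (32 * S) * h"
    by simp
  then have "P div h < 32 * S"
    by (rule less_mult_imp_div_less)
  then have I: "Suc I \<le> 34 * S"
    using assms by (simp add: I_def)
  have "P \<le> I * h"
    using dividend_less_div_times[OF h, of P] by (simp add: I_def)
  then have xI: "x I = int P"
    by (simp add: x_def)
  have step: "x (Suc i) - x i \<le> int h" for i
  proof -
    have "min (Suc i * h) P \<le> min (i * h) P + h"
      by (simp add: min_def)
    then show ?thesis
      unfolding x_def by linarith
  qed
  show ?thesis
  proof (rule that[of x I])
    fix i
    show "0 \<le> x i \<and> x i \<le> int P" "x i \<le> x (Suc i)"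
      by (auto simp: x_def min_def)
    have "16 * int S * (x (Suc i) - x i) \<le> 16 * int S * int h"
      using step by (intro mult_left_mono) auto
    also have "\<dots> \<le> int P"
      using h_le by (metis of_nat_le_iff of_nat_mult of_nat_numeral)
    finally show "16 * int S * (x (Suc i) - x i) \<le> int P" .
  qed (use xI I in \<open>auto simp: x_def\<close>)
qed

text \<open>Averaging: as the translate of \<open>A\<close> runs over the whole torus, each of its
  points visits every position once, so some translate does no worse than the mean.\<close>

lemma exists_good_shift:
  fixes \<beta> :: "int \<Rightarrow> int \<Rightarrow> real" and M N :: nat
  assumes per1: "\<And>x y. \<beta> (x + int M) y = \<beta> x y" and per2: "\<And>x y. \<beta> x (y + int N) = \<beta> x y"
    and avg: "real (card A) * (\<Sum>x = 0..<int M. \<Sum>y = 0..<int N. \<beta> x y) < real M * real N * \<epsilon>"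
  obtains x\<^sub>0 y\<^sub>0 where "x\<^sub>0 \<in> {0..<int M}" "y\<^sub>0 \<in> {0..<int N}" "(\<Sum>a\<in>A. \<beta> (x\<^sub>0 + u a) (y\<^sub>0 + v a)) < \<epsilon>"
proof (rule ccontr)
  assume "\<not> thesis"
  with that have ge: "\<epsilon> \<le> (\<Sum>a\<in>A. \<beta> (x + u a) (y + v a))" if "x \<in> {0..<int M}" "y \<in> {0..<int N}" for x y
    using \<open>x \<in> _\<close> \<open>y \<in> _\<close> not_less by blast
  have "real M * real N * \<epsilon> = (\<Sum>x = 0..<int M. \<Sum>y = 0..<int N. \<epsilon>)"
    by simp
  also have "\<dots> \<le> (\<Sum>x = 0..<int M. \<Sum>y = 0..<int N. \<Sum>a\<in>A. \<beta> (x + u a) (y + v a))"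
    by (intro sum_mono ge)
  also have "\<dots> = (\<Sum>x = 0..<int M. \<Sum>a\<in>A. \<Sum>y = 0..<int N. \<beta> (x + u a) (y + v a))"
    by (intro sum.cong refl sum.swap)
  also have "\<dots> = (\<Sum>x = 0..<int M. \<Sum>a\<in>A. \<Sum>y = 0..<int N. \<beta> (x + u a) y)"
    by (intro sum.cong refl sum_periodic_shift per2)
  also have "\<dots> = (\<Sum>a\<in>A. \<Sum>x = 0..<int M. \<Sum>y = 0..<int N. \<beta> (x + u a) y)"
    by (rule sum.swap)
  also have "\<dots> = (\<Sum>a\<in>A. \<Sum>x = 0..<int M. \<Sum>y = 0..<int N. \<beta> x y)"
    using per1 by (intro sum.cong refl sum_periodic_shift[where f = "\<lambda>x. \<Sum>y = 0..<int N. \<beta> x y"]) simp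
  also have "\<dots> = real (card A) * (\<Sum>x = 0..<int M. \<Sum>y = 0..<int N. \<beta> x y)"
    by simp
  finally show False
    using avg by simp
qed

text \<open>The constant is 11560000 = 34^2 * 100^2: the grid has at most \<open>34 * R\<close>
  times \<open>34 * Q\<close> points, and both smoothing errors have to be at most 1/100 at each of
  them.\<close>

lemma zak_unimodular_tails:
  fixes M N Q R :: nat
  assumes Q: "Q > 0" "16 * Q \<le> N" and R: "R > 0" "16 * R \<le> M"
    and b: "b \<in> l2_space M N" and unimod: "\<And>m n. cmod (zak M N b m n) = 1"
  shows "1 / real M * (\<Sum>j = int (M * Q)..<int (M * N). (cmod (b j))\<^sup>2)
      + 1 / real N * (\<Sum>k = int (N * R)..<int (M * N). (cmod (finite_fourier M N b k))\<^sup>2)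
    \<ge> (1 / 11560000) / (real Q * real R)" (is "?E \<ge> _")
proof (rule ccontr)
  assume "\<not> ?thesis"
  then have E: "?E < (1 / 11560000) / (real Q * real R)"
    by simp
  have pos: "M > 0" "N > 0"
    using Q R by auto
  let ?F = "finite_fourier M N b"
  \<comment> \<open>Reversing \<open>y\<close> gives the quasi-periodicity factor a positive sign
    and matches the Fourier side, where \<open>x\<close> and \<open>y\<close> exchange
    roles.\<close>
  define G where "G x y = zak M N b x (- y)" for x y
  have G_unimod: "cmod (G x y) = 1" for x y
    by (simp add: G_def unimod)
  have G_side: "G (x + int M) y = unit_char (of_int y / N) * G x y" for x y
    using zak_quasiperiodic[OF b pos(2)] by (simp add: G_def)
  have G_top: "G x (y + int N) = G x y" for x y
    using zak_periodic[OF pos(2), of M b x "- y - int N"] by (simp add: G_def)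
  have G_fourier: "G x y = unit_char (of_int x * of_int y / (real M * real N)) * zak N M ?F y x" for x y
    unfolding G_def by (rule zak_finite_fourier[OF b pos])
  have F_unimod: "cmod (zak N M ?F n m) = 1" for n m
    using G_unimod[of m n] by (simp add: G_fourier norm_mult)

  \<comment> \<open>\<open>T\<^sub>1\<close> is the error for steps in \<open>y\<close>, paid for by
    the tail of \<open>b\<close>; \<open>T\<^sub>2\<close> is the error for steps in
    \<open>x\<close>, paid for by the tail of the Fourier transform.\<close>
  obtain T\<^sub>1 :: "int \<Rightarrow> int \<Rightarrow> complex" where T1:
    "(\<Sum>m = 0..<int M. \<Sum>t = 0..<int N. (cmod (T\<^sub>1 m t))\<^sup>2) \<le> N * (\<Sum>j = int (M * Q)..<int (M * N). (cmod (b j))\<^sup>2)"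
    "\<And>m t. T\<^sub>1 m (t + int N) = T\<^sub>1 m t"
    "\<And>m t h. h \<ge> 0 \<Longrightarrow> cmod (zak M N b m (t + h) - zak M N b m t)
        \<le> 2 * pi * of_int h / N * (5 / 2 * Q) + cmod (T\<^sub>1 m (t + h)) + cmod (T\<^sub>1 m t)"
    by (rule zak_smooth_approximation[OF pos(1) Q(1) _ eq_refl[OF unimod]]) (use Q in simp, rule that)
  obtain T\<^sub>2 :: "int \<Rightarrow> int \<Rightarrow> complex" where T2:
    "(\<Sum>n = 0..<int N. \<Sum>t = 0..<int M. (cmod (T\<^sub>2 n t))\<^sup>2) \<le> M * (\<Sum>j = int (N * R)..<int (N * M). (cmod (?F j))\<^sup>2)"
    "\<And>m t. T\<^sub>2 m (t + int M) = T\<^sub>2 m t"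
    "\<And>m t h. h \<ge> 0 \<Longrightarrow> cmod (zak N M ?F m (t + h) - zak N M ?F m t)
        \<le> 2 * pi * of_int h / M * (5 / 2 * R) + cmod (T\<^sub>2 m (t + h)) + cmod (T\<^sub>2 m t)"
    by (rule zak_smooth_approximation[OF pos(2) R(1) _ eq_refl[OF F_unimod]]) (use R in simp, rule that)

  \<comment> \<open>A translated grid can run past \<open>M\<close> but stays below
    \<open>2 * M\<close>. The energy bound covers only reduced \<open>m\<close>, so \<open>x\<close>
    is reduced; beyond \<open>M\<close> the quasi-periodicity factor varies with \<open>y\<close>
    and costs the additional \<open>?d\<close>.\<close>
  have vert: "cmod (G x (y + h) - G x y) \<le> 1.38 + cmod (T\<^sub>1 (x mod int M) (- (y + h))) + cmod (T\<^sub>1 (x mod int M) (- y))"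
    if x: "0 \<le> x" "x < 2 * int M" and h: "h \<ge> 0" "16 * int Q * h \<le> int N" for x y h
  proof -
    define m where "m = x mod int M"
    let ?d = "2 * pi * of_int h / real N"
    have d: "?d \<ge> 0"
      using h by simp
    have base: "cmod (G m (y + h) - G m y) \<le> ?d * (5 / 2 * Q) + cmod (T\<^sub>1 m (- (y + h))) + cmod (T\<^sub>1 m (- y))"
      using T1(3)[OF h(1), of m "- (y + h)"] by (simp add: G_def norm_minus_commute)
    have "cmod (G x (y + h) - G x y) \<le> ?d + cmod (G m (y + h) - G m y)"
    proof (cases "x < int M")
      case True
      then have "x = m"
        using x by (simp add: m_def)
      then show ?thesis
        using d by simp
    next
      case False
      then have "x mod int M = (x - int M) mod int M"
        by simp
      also have "\<dots> = x - int M"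
        using False x by (intro mod_pos_pos_trivial) auto
      finally have "x = m + int M"
        by (simp add: m_def)
      then have "cmod (G x (y + h) - G x y)
          \<le> cmod (unit_char (of_int (y + h) / N) - unit_char (of_int y / N)) + cmod (G m (y + h) - G m y)"
        using norm_diff_rotated_le by (simp only: G_side G_unimod norm_unit_char)
      also have "cmod (unit_char (of_int (y + h) / N) - unit_char (of_int y / N)) \<le> ?d"
        using norm_unit_char_diff[of "of_int (y + h) / N" "of_int y / N"] h by (simp add: add_divide_distrib)
      finally show ?thesis
        by simp
    qed
    then show ?thesis
      using base jump_budget[OF Q(1) pos(2) h(2)] by (simp add: m_def)
  qed

  \<comment> \<open>Reducing \<open>y\<close> modulo \<open>N\<close> changes nothing in
    \<open>G\<close> and makes \<open>n / N < 1\<close>, so the phase relating \<open>G\<close> to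
    the Fourier side turns by at most \<open>?d\<close>.\<close>
  have hor: "cmod (G (x + h) y - G x y) \<le> 1.38 + cmod (T\<^sub>2 (y mod int N) (x + h)) + cmod (T\<^sub>2 (y mod int N) x)"
    if h: "h \<ge> 0" "16 * int R * h \<le> int M" for x y h
  proof -
    define n where "n = y mod int N"
    have n: "0 \<le> n" "n < int N"
      using pos by (simp_all add: n_def)
    let ?d = "2 * pi * of_int h / real M"
    let ?u = "\<lambda>x. unit_char (of_int x * of_int n / (real M * real N))"
    have Gn: "G z y = ?u z * zak N M ?F n z" for z
      using periodic_mod[of "G z" "int N" y, OF G_top] G_fourier[of z n] by (simp add: n_def)
    have "cmod (G (x + h) y - G x y) \<le> cmod (?u (x + h) - ?u x) + cmod (zak N M ?F n (x + h) - zak N M ?F n x)"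
      unfolding Gn by (intro norm_diff_rotated_le) (simp_all add: F_unimod)
    moreover have "cmod (?u (x + h) - ?u x) \<le> ?d"
    proof -
      have "of_int (x + h) * of_int n / (real M * real N) - of_int x * of_int n / (real M * real N)
          = of_int h / real M * (of_int n / real N)"
        by (simp add: ring_distribs add_divide_distrib)
      moreover have "of_int h / real M * (of_int n / real N) \<le> of_int h / real M"
        using n h by (intro mult_left_le) auto
      moreover have "0 \<le> of_int h / real M * (of_int n / real N)"
        using n h by simp
      ultimately have "\<bar>of_int (x + h) * of_int n / (real M * real N) - of_int x * of_int n / (real M * real N)\<bar> \<le> of_int h / real M"
        by simp
      then have "2 * pi * \<bar>of_int (x + h) * of_int n / (real M * real N) - of_int x * of_int n / (real M * real N)\<bar> \<le> 2 * pi * (of_int h / real M)"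
        by (intro mult_left_mono) auto
      then show ?thesis
        using norm_unit_char_diff[of "of_int (x + h) * of_int n / (real M * real N)" "of_int x * of_int n / (real M * real N)"]
        by simp
    qed
    moreover note T2(3)[OF h(1), of n x]
    ultimately show ?thesis
      using jump_budget[OF R(1) pos(1) h(2)] by (simp add: n_def)
  qed

  \<comment> \<open>The reductions make this error density periodic in both variables, as averaging
    over translates requires.\<close>
  define \<beta> where "\<beta> x y = (cmod (T\<^sub>1 (x mod int M) (- y)))\<^sup>2 + (cmod (T\<^sub>2 (y mod int N) x))\<^sup>2" for x y
  have \<beta>_sum: "(\<Sum>x = 0..<int M. \<Sum>y = 0..<int N. \<beta> x y) \<le> real M * real N * ?E"
  proof -
    have "(\<Sum>x = 0..<int M. \<Sum>y = 0..<int N. (cmod (T\<^sub>1 (x mod int M) (- y)))\<^sup>2)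
        = (\<Sum>x = 0..<int M. \<Sum>y = 0..<int N. (cmod (T\<^sub>1 x y))\<^sup>2)"
    proof (rule sum.cong[OF refl])
      fix x assume "x \<in> {0..<int M}"
      then show "(\<Sum>y = 0..<int N. (cmod (T\<^sub>1 (x mod int M) (- y)))\<^sup>2) = (\<Sum>y = 0..<int N. (cmod (T\<^sub>1 x y))\<^sup>2)"
        using sum_periodic_reflect[of "\<lambda>y. (cmod (T\<^sub>1 x y))\<^sup>2" "int N" 0] T1(2) by simp
    qed
    moreover have "(\<Sum>x = 0..<int M. \<Sum>y = 0..<int N. (cmod (T\<^sub>2 (y mod int N) x))\<^sup>2)
        = (\<Sum>y = 0..<int N. \<Sum>x = 0..<int M. (cmod (T\<^sub>2 y x))\<^sup>2)"
      by (subst sum.swap) (intro sum.cong refl, simp)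
    ultimately have "(\<Sum>x = 0..<int M. \<Sum>y = 0..<int N. \<beta> x y)
        \<le> N * (\<Sum>j = int (M * Q)..<int (M * N). (cmod (b j))\<^sup>2) + M * (\<Sum>j = int (N * R)..<int (M * N). (cmod (?F j))\<^sup>2)"
      unfolding \<beta>_def sum.distrib using T1(1) T2(1) by (simp add: mult.commute[of N M])
    also have "\<dots> = real M * real N * ?E"
      using pos by (simp add: field_simps)
    finally show ?thesis .
  qed

  obtain I x where x: "x 0 = 0" "x I = int M" "\<And>i. 0 \<le> x i \<and> x i \<le> int M" "\<And>i. x i \<le> x (Suc i)"
    "\<And>i. 16 * int R * (x (Suc i) - x i) \<le> int M" "Suc I \<le> 34 * R"
    by (rule coarse_partition[OF R]) (rule that)
  obtain J y where y: "y 0 = 0" "y J = int N" "\<And>i. 0 \<le> y i \<and> y i \<le> int N" "\<And>i. y i \<le> y (Suc i)"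
    "\<And>i. 16 * int Q * (y (Suc i) - y i) \<le> int N" "Suc J \<le> 34 * Q"
    by (rule coarse_partition[OF Q]) (rule that)
  let ?A = "{..I} \<times> {..J}"
  have "card ?A \<le> (34 * R) * (34 * Q)"
    unfolding card_cartesian_product card_atMost by (intro mult_le_mono x y)
  then have card: "real (card ?A) \<le> 1156 * (real Q * real R)"
    using of_nat_mono[of "card ?A" "(34 * R) * (34 * Q)", where 'a = real] by (simp add: mult_ac)
  have avg: "real (card ?A) * (\<Sum>x = 0..<int M. \<Sum>y = 0..<int N. \<beta> x y) < real M * real N * (1 / 10000)"
  proof -
    define e where "e = ?E"
    have e0: "e \<ge> 0"
      unfolding e_def by (intro add_nonneg_nonneg mult_nonneg_nonneg sum_nonneg) auto
    have QR: "real Q * real R > 0"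
      using Q(1) R(1) by simp
    have e: "e * (real Q * real R) < 1 / 11560000"
      using E QR unfolding e_def by (simp only: pos_less_divide_eq)
    have "real (card ?A) * (\<Sum>x = 0..<int M. \<Sum>y = 0..<int N. \<beta> x y)
        \<le> real (card ?A) * (real M * real N * e)"
      unfolding e_def by (rule mult_left_mono[OF \<beta>_sum of_nat_0_le_iff])
    also have "\<dots> \<le> (1156 * (real Q * real R)) * (real M * real N * e)"
      using card e0 by (intro mult_right_mono) auto
    also have "\<dots> = (real M * real N) * (1156 * (e * (real Q * real R)))"
      by (simp only: mult_ac)
    also have "\<dots> < (real M * real N) * (1 / 10000)"
      using pos e by (intro mult_strict_left_mono) auto
    finally show ?thesis .
  qed
  have per: "\<beta> (z + int M) w = \<beta> z w" "\<beta> z (w + int N) = \<beta> z w" for z w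
    using T1(2)[of "z mod int M" "- w - int N"] T2(2) by (simp_all add: \<beta>_def)
  obtain x\<^sub>0 y\<^sub>0 where off: "x\<^sub>0 \<in> {0..<int M}" "y\<^sub>0 \<in> {0..<int N}"
    "(\<Sum>a\<in>?A. \<beta> (x\<^sub>0 + x (fst a)) (y\<^sub>0 + y (snd a))) < 1 / 10000"
    by (rule exists_good_shift[of \<beta> M N ?A "1 / 10000" "\<lambda>a. x (fst a)" "\<lambda>a. y (snd a)", OF per avg]) (rule that)
  \<comment> \<open>All terms are nonnegative, so the bound on the sum caps both errors at each grid
    point. Two such errors use up exactly the slack between 1.38 and 1.4.\<close>
  have small: "cmod (T\<^sub>1 ((x\<^sub>0 + x i) mod int M) (- (y\<^sub>0 + y j))) \<le> 1 / 100"
    "cmod (T\<^sub>2 ((y\<^sub>0 + y j) mod int N) (x\<^sub>0 + x i)) \<le> 1 / 100" if "i \<le> I" "j \<le> J" for i j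
  proof -
    have nonneg: "0 \<le> \<beta> z w" for z w
      by (simp add: \<beta>_def)
    have "\<beta> (x\<^sub>0 + x i) (y\<^sub>0 + y j) \<le> (\<Sum>a\<in>?A. \<beta> (x\<^sub>0 + x (fst a)) (y\<^sub>0 + y (snd a)))"
      using member_le_sum[of "(i, j)" ?A "\<lambda>a. \<beta> (x\<^sub>0 + x (fst a)) (y\<^sub>0 + y (snd a))", OF _ nonneg] that
      by simp
    then have "\<beta> (x\<^sub>0 + x i) (y\<^sub>0 + y j) \<le> (1 / 100)\<^sup>2"
      using off(3) by (simp add: power2_eq_square)
    then have "(cmod (T\<^sub>1 ((x\<^sub>0 + x i) mod int M) (- (y\<^sub>0 + y j))))\<^sup>2 \<le> (1 / 100)\<^sup>2"
      "(cmod (T\<^sub>2 ((y\<^sub>0 + y j) mod int N) (x\<^sub>0 + x i)))\<^sup>2 \<le> (1 / 100)\<^sup>2"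
      unfolding \<beta>_def by (smt (verit) zero_le_power2)+
    then show "cmod (T\<^sub>1 ((x\<^sub>0 + x i) mod int M) (- (y\<^sub>0 + y j))) \<le> 1 / 100"
      "cmod (T\<^sub>2 ((y\<^sub>0 + y j) mod int N) (x\<^sub>0 + x i)) \<le> 1 / 100"
      by (auto intro: power2_le_imp_le)
  qed

  \<comment> \<open>The quasi-periodicity factor makes one full turn from bottom to top, so these
    two numbers differ by 1; their equality is the contradiction.\<close>
  have "of_int (y\<^sub>0 + y J) / real N = of_int (y\<^sub>0 + y 0) / real N"
  proof (rule no_winding_if_small_jumps[where g = "\<lambda>i j. G (x\<^sub>0 + x i) (y\<^sub>0 + y j)" and I = I and y = "\<lambda>j. of_int (y\<^sub>0 + y j) / real N"])
    show "G (x\<^sub>0 + x i) (y\<^sub>0 + y j) \<noteq> 0" for i j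
      using G_unimod by (metis norm_zero zero_neq_one)
    show "Re (G (x\<^sub>0 + x (Suc i)) (y\<^sub>0 + y j) / G (x\<^sub>0 + x i) (y\<^sub>0 + y j)) > 0" if "i < I" "j \<le> J" for i j
    proof (rule Re_quotient_pos[OF G_unimod G_unimod])
      show "cmod (G (x\<^sub>0 + x (Suc i)) (y\<^sub>0 + y j) - G (x\<^sub>0 + x i) (y\<^sub>0 + y j)) \<le> 1.4"
        using hor[of "x (Suc i) - x i" "x\<^sub>0 + x i" "y\<^sub>0 + y j"] x(4,5)[of i]
          small(2)[of i j] small(2)[of "Suc i" j] that by simp
    qed
    show "Re (G (x\<^sub>0 + x i) (y\<^sub>0 + y (Suc j)) / G (x\<^sub>0 + x i) (y\<^sub>0 + y j)) > 0" if "i \<le> I" "j < J" for i j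
    proof (rule Re_quotient_pos[OF G_unimod G_unimod])
      have "0 \<le> x\<^sub>0 + x i" "x\<^sub>0 + x i < 2 * int M"
        using x(3)[of i] off(1) by auto
      from vert[OF this, of "y (Suc j) - y j" "y\<^sub>0 + y j"]
      show "cmod (G (x\<^sub>0 + x i) (y\<^sub>0 + y (Suc j)) - G (x\<^sub>0 + x i) (y\<^sub>0 + y j)) \<le> 1.4"
        using y(4,5)[of j] small(1)[of i j] small(1)[of i "Suc j"] that by simp
    qed
    show "G (x\<^sub>0 + x i) (y\<^sub>0 + y J) = G (x\<^sub>0 + x i) (y\<^sub>0 + y 0)" for i
      by (simp add: y G_top)
    show "G (x\<^sub>0 + x I) (y\<^sub>0 + y j) = unit_char (of_int (y\<^sub>0 + y j) / N) * G (x\<^sub>0 + x 0) (y\<^sub>0 + y j)" for j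
      by (simp add: x(1,2) G_side)
    \<comment> \<open>Since \<open>Q \<ge> 1\<close>, a step in \<open>y\<close> is at most
      \<open>N / 16\<close>, so this phase advances by at most 1/16 of a turn.\<close>
    show "\<bar>of_int (y\<^sub>0 + y (Suc j)) / real N - of_int (y\<^sub>0 + y j) / real N\<bar> < 1 / 4" for j
    proof -
      define h where "h = y (Suc j) - y j"
      have "16 * h \<le> 16 * int Q * h"
        using Q(1) y(4)[of j] by (intro mult_right_mono) (simp_all add: h_def)
      then have "16 * h \<le> int N" "h \<ge> 0"
        using y(4,5)[of j] by (auto simp: h_def)
      then have "16 * real_of_int h \<le> real N" "real_of_int h \<ge> 0"
        by linarith+
      moreover have "of_int (y\<^sub>0 + y (Suc j)) / real N - of_int (y\<^sub>0 + y j) / real N = of_int h / real N"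
        by (simp add: h_def diff_divide_distrib add_divide_distrib)
      moreover have "of_int h / real N \<le> 1 / 16" "0 \<le> of_int h / real N"
        using \<open>16 * real_of_int h \<le> real N\<close> \<open>h \<ge> 0\<close> pos by (simp_all add: pos_divide_le_eq)
      ultimately show ?thesis
        by linarith
    qed
  qed
  then show False
    using pos y by simp
qed

theorem theorem1p10:
  shows "\<exists>C::real. C > 0 \<and>
    (\<forall>(M::nat) (N::nat) (b :: int \<Rightarrow> complex).
       M \<ge> 200 \<longrightarrow> N \<ge> 200 \<longrightarrow>
       b \<in> l2_space M N \<longrightarrow>
       l2_orthonormal_basis M N (gabor_index M N) (gabor M N b) \<longrightarrow>
       (\<forall>(Q::nat) (R::nat).
          Q > 0 \<longrightarrow> R > 0 \<longrightarrow> real Q \<le> real N / 16 \<longrightarrow> real R \<le> real M / 16 \<longrightarrow>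
          1 / real M * (\<Sum>j = int (M * Q)..<int (M * N). (cmod (b j))\<^sup>2)
          + 1 / real N * (\<Sum>k = int (N * R)..<int (M * N). (cmod (finite_fourier M N b k))\<^sup>2)
          \<ge> C / (real Q * real R)))"
proof (intro exI[of _ "1 / 11560000"] conjI allI impI)
  fix M N Q R :: nat and b :: "int \<Rightarrow> complex"
  assume *: "M \<ge> 200" "N \<ge> 200" "b \<in> l2_space M N"
    "l2_orthonormal_basis M N (gabor_index M N) (gabor M N b)"
    "Q > 0" "R > 0" "real Q \<le> real N / 16" "real R \<le> real M / 16"
  show "(1 / 11560000) / (real Q * real R)
    \<le> 1 / real M * (\<Sum>j = int (M * Q)..<int (M * N). (cmod (b j))\<^sup>2)
          + 1 / real N * (\<Sum>k = int (N * R)..<int (M * N). (cmod (finite_fourier M N b k))\<^sup>2)"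
  proof (rule zak_unimodular_tails)
    show "16 * Q \<le> N" "16 * R \<le> M"
      using * by linarith+
    show "cmod (zak M N b m n) = 1" for m n
      using * by (intro zak_unimodular) auto
  qed (use * in auto)
qed simp

end
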